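(* For any $n\ge1$ and $m,k\ge0$, a monomial $x^ay^bx_1^{a_1}y_1^{b_1}\cdots x_n^{a_n}y_n^{b_n}$ is the trailing term of some polynomial $g\in H^0\left(\mathrm{Hilb}^{n,n+1}(\mathbb{C}^2),\mathcal{O}(m,k)\right)$ if and only if: (1) $a,b\ge0$; (2) $0\le a_1\le a_2\le\cdots\le a_n$; (3) for any $j=1,\dots,n-1$ for which $a_j=a_{j+1}$, we have $b_{j+1}\ge b_j+m+k$; and (4) for each $j=1,\dots,n$, we have $$b_j\ge\max\{k-a_j,0\}+\sum_{i=1}^{j-1}\max\{m+k-(a_j-a_i),0\}.$$
   Context: The nested Hilbert scheme $\mathrm{Hilb}^{n,n+1}(\mathbb{C}^2)$ parametrizes pairs of subschemes $Z\subset Z'$ of $\mathbb{C}^2$ of lengths $n$ and $n+1$, with projections $\pi_n,\pi_{n+1}$ to $\mathrm{Hilb}^n(\mathbb{C}^2)$ and $\mathrm{Hilb}^{n+1}(\mathbb{C}^2)$. On a Hilbert scheme of points $\mathcal{O}(1)$ is the determinant of the tautological bundle (fiber $\mathbb{C}[x,y]/\mathcal{I}$ at $\mathcal{I}$), $\mathcal{O}(d)=\mathcal{O}(1)^{\otimes d}$, and $\mathcal{O}(m,k)=\pi_n^*\mathcal{O}(m)\otimes\pi_{n+1}^*\mathcal{O}(k)$. For $m,k\geq 0$, $H^0(\mathrm{Hilb}^{n,n+1}(\mathbb{C}^2),\mathcal{O}(m,k))$ is identified with a space of polynomials, namely the $\mathrm{sgn}(m+k)$-component of $J^{m+k}\cap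 I^k\subseteq\mathbb{C}[x_1,y_1,\dots,x_n,y_n,x,y]$, where $J=\bigcap_{i<j}(x_i-x_j,y_i-y_j)$ (for $n=1$ the whole ring) and $I=\bigcap_{i=1}^n(x_i-x,y_i-y)$. Here $S_n$ permutes the pairs $(x_i,y_i)$ simultaneously and fixes $x,y$, and $\mathrm{sgn}(d)$ is the trivial character for $d$ even and the sign character for $d$ odd. The statement concerns polynomials in this space. The monomial order is lexicographic with $x<y<x_1<\cdots<x_n<y_1<\cdots<y_n$: the trailing term of a nonzero polynomial is its term whose exponent vector $(a,b,a_1,\dots,a_n,b_1,\dots,b_n)$ is lexicographically minimal among all its terms (trailing terms are considered up to nonzero scalar). Exponents are integers. *)

theory Defs
  imports
    Complex_Main
    "HOL-Algebra.Ideal_Product"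
    "HOL-Combinatorics.Permutations"
    "HOL-Library.Poly_Mapping"
begin

section \<open>The polynomial ring\<close>

text \<open>
  The variables \<open>x\<close>, \<open>y\<close>, \<open>x\<^sub>i\<close>, \<open>y\<^sub>i\<close>. A polynomial is a finitely supported function from
  exponents (themselves finitely supported functions on the variables) to the complex numbers.
  The type has variables for every natural index; the ring in \<open>x\<^sub>1, y\<^sub>1, \<dots>, x\<^sub>n, y\<^sub>n, x, y\<close> is
  the subring carved out by the carrier of \<open>poly_ring n\<close>.
\<close>

datatype var = X | Y | Xi nat | Yi nat

type_synonym expo = "var \<Rightarrow>\<^sub>0 nat"
type_synonym cpoly = "expo \<Rightarrow>\<^sub>0 complex"

definition vars :: "nat \<Rightarrow> var set" where
  "vars n = {X, Y} \<union> Xi ` {1..n} \<union> Yi ` {1..n}"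

definition poly_ring :: "nat \<Rightarrow> cpoly ring" where
  "poly_ring n =
     \<lparr>carrier = {p. \<forall>e \<in> Poly_Mapping.keys p. Poly_Mapping.keys e \<subseteq> vars n},
      monoid.mult = (*), one = 1, zero = 0, add = (+)\<rparr>"

definition pvar :: "var \<Rightarrow> cpoly" where
  "pvar v = Poly_Mapping.single (Poly_Mapping.single v 1) 1"

lemma poly_ring_cring: "cring (poly_ring n)"
proof -
  have add: "p + q \<in> carrier (poly_ring n)"
    if "p \<in> carrier (poly_ring n)" "q \<in> carrier (poly_ring n)" for p q
    using that Poly_Mapping.keys_add[of p q] by (fastforce simp: poly_ring_def)
  have mult: "p * q \<in> carrier (poly_ring n)"
    if "p \<in> carrier (poly_ring n)" "q \<in> carrier (poly_ring n)" for p q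
  proof -
    have "Poly_Mapping.keys e \<subseteq> vars n" if e: "e \<in> Poly_Mapping.keys (p * q)" for e
    proof -
      obtain a b where "e = a + b" "a \<in> Poly_Mapping.keys p" "b \<in> Poly_Mapping.keys q"
        using e keys_mult[of p q] by blast
      then show ?thesis
        using \<open>p \<in> _\<close> \<open>q \<in> _\<close> Poly_Mapping.keys_add[of a b] by (fastforce simp: poly_ring_def)
    qed
    then show ?thesis by (simp add: poly_ring_def)
  qed
  have uminus: "- p \<in> carrier (poly_ring n)" if "p \<in> carrier (poly_ring n)" for p
    using that by (simp add: poly_ring_def)
  have "0 \<in> carrier (poly_ring n)" "1 \<in> carrier (poly_ring n)"
    by (simp_all add: poly_ring_def)
  moreover have "\<exists>q \<in> carrier (poly_ring n). q + p = 0" if "p \<in> carrier (poly_ring n)" for p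
    using uminus[OF that] by (intro bexI[of _ "- p"]) auto
  moreover have ops: "p \<otimes>\<^bsub>poly_ring n\<^esub> q = p * q" "p \<oplus>\<^bsub>poly_ring n\<^esub> q = p + q"
    "\<one>\<^bsub>poly_ring n\<^esub> = 1" "\<zero>\<^bsub>poly_ring n\<^esub> = 0" for p q
    by (simp_all add: poly_ring_def)
  ultimately show ?thesis
    using add mult
    by (intro cringI abelian_groupI comm_monoidI; unfold ops)
      (blast intro: add.assoc add.commute add_0 mult.assoc mult.commute mult_1 distrib_right)+
qed

section \<open>The ideals \<open>I\<close> and \<open>J\<close>, and the space of sections\<close>

text \<open>
  Intersecting with the carrier makes \<open>J\<close> the whole ring for \<open>n = 1\<close>, where there are no
  pairs \<open>i < j\<close>.
\<close>

definition ideal_J :: "nat \<Rightarrow> cpoly set" where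
  "ideal_J n = carrier (poly_ring n) \<inter>
     (\<Inter>(i, j) \<in> {(i, j). 1 \<le> i \<and> i < j \<and> j \<le> n}.
        Idl\<^bsub>poly_ring n\<^esub> {pvar (Xi i) - pvar (Xi j), pvar (Yi i) - pvar (Yi j)})"

definition ideal_I :: "nat \<Rightarrow> cpoly set" where
  "ideal_I n = carrier (poly_ring n) \<inter>
     (\<Inter>i \<in> {1..n}. Idl\<^bsub>poly_ring n\<^esub> {pvar (Xi i) - pvar X, pvar (Yi i) - pvar Y})"

text \<open>
  The simultaneous action of permutations: precomposing exponents with \<open>\<sigma>\<close> on the indices sends
  \<open>x\<^sub>i\<close> to \<open>x\<close> with index \<open>\<sigma> i\<close>, and likewise for \<open>y\<^sub>i\<close>; see \<open>perm_poly_pvar\<close>.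
\<close>

fun perm_var :: "(nat \<Rightarrow> nat) \<Rightarrow> var \<Rightarrow> var" where
  "perm_var \<sigma> X = X"
| "perm_var \<sigma> Y = Y"
| "perm_var \<sigma> (Xi i) = Xi (\<sigma> i)"
| "perm_var \<sigma> (Yi i) = Yi (\<sigma> i)"

definition perm_poly :: "(nat \<Rightarrow> nat) \<Rightarrow> cpoly \<Rightarrow> cpoly" where
  "perm_poly \<sigma> p = Poly_Mapping.map_key (Poly_Mapping.map_key (perm_var \<sigma>)) p"

lemma perm_var_bij:
  assumes "bij \<sigma>"
  shows "bij (perm_var \<sigma>)"
proof (rule o_bij[of "perm_var (inv_into UNIV \<sigma>)"])
  show "perm_var (inv_into UNIV \<sigma>) \<circ> perm_var \<sigma> = id"
  proof
    show "(perm_var (inv_into UNIV \<sigma>) \<circ> perm_var \<sigma>) v = id v" for v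
      using assms by (cases v) (auto simp: bij_is_inj)
  qed
  show "perm_var \<sigma> \<circ> perm_var (inv_into UNIV \<sigma>) = id"
  proof
    show "(perm_var \<sigma> \<circ> perm_var (inv_into UNIV \<sigma>)) v = id v" for v
      using assms by (cases v) (auto simp: bij_is_surj surj_f_inv_f)
  qed
qed

lemma inj_map_key_perm_var:
  assumes "bij \<sigma>"
  shows "inj (Poly_Mapping.map_key (perm_var \<sigma>) :: expo \<Rightarrow> expo)"
proof (rule injI)
  fix d e :: expo
  assume eq: "Poly_Mapping.map_key (perm_var \<sigma>) d = Poly_Mapping.map_key (perm_var \<sigma>) e"
  have bij: "bij (perm_var \<sigma>)" by (rule perm_var_bij[OF assms])
  show "d = e"
  proof (rule poly_mapping_eqI)
    fix v
    obtain w where "v = perm_var \<sigma> w" using bij by (metis bij_pointE)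
    then show "Poly_Mapping.lookup d v = Poly_Mapping.lookup e v"
      using arg_cong[OF eq, of "\<lambda>f. Poly_Mapping.lookup f w"] bij
      by (simp add: map_key.rep_eq bij_is_inj)
  qed
qed

lemma perm_poly_pvar:
  assumes "\<sigma> permutes {1..n}"
  shows "perm_poly \<sigma> (pvar v) = pvar (perm_var \<sigma> v)"
proof -
  have bij: "bij \<sigma>" using assms by (rule permutes_bij)
  have "Poly_Mapping.map_key (perm_var \<sigma>) (Poly_Mapping.single (perm_var \<sigma> v) (1::nat)) =
          Poly_Mapping.single v 1"
    using perm_var_bij[OF bij] by (intro map_key_single bij_is_inj)
  then show ?thesis
    using map_key_single[OF inj_map_key_perm_var[OF bij],
        of "Poly_Mapping.single (perm_var \<sigma> v) 1" "1::complex"]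
    by (simp add: perm_poly_def pvar_def)
qed

definition sgn_char :: "nat \<Rightarrow> (nat \<Rightarrow> nat) \<Rightarrow> int" where
  "sgn_char d \<sigma> = (if even d then 1 else sign \<sigma>)"

text \<open>
  The space of polynomials identified with \<open>H\<^sup>0(Hilb(n,n+1), O(m,k))\<close>: the
  \<open>sgn(m+k)\<close>-component of \<open>J\<^sup>m\<^sup>+\<^sup>k \<inter> I\<^sup>k\<close>. Powers are taken in the monoid of ideals.
\<close>

definition H0 :: "nat \<Rightarrow> nat \<Rightarrow> nat \<Rightarrow> cpoly set" where
  "H0 n m k =
     {g \<in> (ideal_J n [^]\<^bsub>ideals_set (poly_ring n)\<^esub> (m + k)) \<inter>
          (ideal_I n [^]\<^bsub>ideals_set (poly_ring n)\<^esub> k).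
        \<forall>\<sigma>. \<sigma> permutes {1..n} \<longrightarrow> perm_poly \<sigma> g = of_int (sgn_char (m + k) \<sigma>) * g}"

section \<open>Trailing terms\<close>

text \<open>
  The vector \<open>(a, b, a\<^sub>1, \<dots>, a\<^sub>n, b\<^sub>1, \<dots>, b\<^sub>n)\<close> of integer exponents of
  \<open>x\<^sup>a y\<^sup>b x\<^sub>1 \<dots> y\<^sub>n\<close>; only the values of \<open>as\<close> and \<open>bs\<close> at \<open>1, \<dots>, n\<close> matter.
\<close>

definition exp_vec :: "nat \<Rightarrow> int \<Rightarrow> int \<Rightarrow> (nat \<Rightarrow> int) \<Rightarrow> (nat \<Rightarrow> int) \<Rightarrow> int list" where
  "exp_vec n a b as bs = [a, b] @ map as [1..<Suc n] @ map bs [1..<Suc n]"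

definition expo_vec :: "nat \<Rightarrow> expo \<Rightarrow> int list" where
  "expo_vec n e =
     exp_vec n (int (Poly_Mapping.lookup e X)) (int (Poly_Mapping.lookup e Y))
       (\<lambda>i. int (Poly_Mapping.lookup e (Xi i))) (\<lambda>i. int (Poly_Mapping.lookup e (Yi i)))"

definition is_trailing :: "nat \<Rightarrow> cpoly \<Rightarrow> int list \<Rightarrow> bool" where
  "is_trailing n g v \<longleftrightarrow>
     v \<in> expo_vec n ` Poly_Mapping.keys g \<and>
     (\<forall>w \<in> expo_vec n ` Poly_Mapping.keys g. w \<noteq> v \<longrightarrow> (v, w) \<in> lexord {(s, t). s < t})"

end

theory Submission
  imports Defs
begin

text \<open>
  Let \<open>d = m + k\<close>, and call the pairs \<open>(x\<^sub>i, y\<^sub>i)\<close> points and \<open>(x, y)\<close> the extra point.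

  The conditions are necessary. Let \<open>e0\<close> be the trailing exponent of \<open>g\<close>. Nonnegativity is clear, and the
  \<open>a\<^sub>j\<close> increase because permuting the points permutes the monomials of \<open>g\<close>. The bounds on the \<open>b\<^sub>j\<close> come from
  the vanishing of \<open>g\<close> along diagonals. If \<open>g\<close> lies in the \<open>d\<close>-th power of \<open>(x\<^sub>i - x\<^sub>j, y\<^sub>i - y\<^sub>j)\<close>, fix all other
  exponents and the sums of the \<open>x\<close>-exponents and of the \<open>y\<close>-exponents of the two points; then the remaining
  coefficients, as a function of the two exponents of the point \<open>i\<close>, are orthogonal to all polynomials of degree
  below \<open>d\<close>. By minimality and symmetry, these exponents run over a region with \<open>e0\<close>, or another exponent that starts
  like \<open>e0\<close>, at a corner, and a product of linear factors isolates the corner coefficient. Its being nonzero forces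
  at least \<open>d\<close> factors (\<open>order_ge_corner\<close>). Applied to two points with \<open>a\<^sub>i = a\<^sub>j\<close>, this is the gap
  condition for ties; applied to a point and the extra point, and then to the pairs \<open>(1, j), (2, j), \<dots>\<close> in turn, it
  gives the summands of the last condition one by one (\<open>Yi_bound\<close>). The vanishing holds since \<open>J\<^sup>d\<close> is contained in the
  \<open>d\<close>-th power of the ideal of each diagonal between two points, and \<open>I\<^sup>k\<close> in the \<open>k\<close>-th power of the ideal of each
  diagonal between a point and the extra point.

  The conditions are sufficient. For exponent pairs in strictly increasing lexicographic order, the determinant
  with entries \<open>(x\<^sub>i - x)\<^sup>\<alpha> (y\<^sub>i - y)\<^sup>\<beta>\<close> is antisymmetric, lies in \<open>J\<close>, lies in \<open>I\<close> if the pair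
  \<open>(0, 0)\<close> does not occur, and has the diagonal product as its trailing term. Trailing terms multiply, so for \<open>d > 0\<close>
  it remains to write the given exponents as a sum of \<open>d\<close> such sequences of pairs, \<open>k\<close> of them without \<open>(0, 0)\<close>;
  the rounded quotients \<open>(a\<^sub>j + t) div d\<close> for \<open>t < d\<close> do this (\<open>section_exists_pos\<close>), and the inequalities of the
  theorem are exactly what the resulting second exponents need. For \<open>d = 0\<close> one symmetrises a monomial.
\<close>

section \<open>Polynomials as finitely supported functions\<close>

abbreviation lookup :: "('a \<Rightarrow>\<^sub>0 'b::zero) \<Rightarrow> 'a \<Rightarrow> 'b" where
  "lookup \<equiv> Poly_Mapping.lookup"

abbreviation keys :: "('a \<Rightarrow>\<^sub>0 'b::zero) \<Rightarrow> 'a set" where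
  "keys \<equiv> Poly_Mapping.keys"

abbreviation single :: "'a \<Rightarrow> 'b::zero \<Rightarrow> 'a \<Rightarrow>\<^sub>0 'b" where
  "single \<equiv> Poly_Mapping.single"

lemma sum_singles:
  fixes g :: "'a \<Rightarrow>\<^sub>0 'b::comm_monoid_add"
  shows "(\<Sum>e \<in> keys g. single e (lookup g e)) = g"
proof (rule poly_mapping_eqI)
  fix e
  have "lookup (\<Sum>f \<in> keys g. single f (lookup g f)) e = (\<Sum>f \<in> keys g. if f = e then lookup g e else 0)"
    unfolding lookup_sum by (intro sum.cong) (auto simp: lookup_single)
  also have "\<dots> = lookup g e"
    by (auto simp: sum.delta in_keys_iff)
  finally show "lookup (\<Sum>f \<in> keys g. single f (lookup g f)) e = lookup g e" .
qed

lemma poly_single_add_induct [case_names zero single add]: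
  fixes g :: "'a \<Rightarrow>\<^sub>0 'b::comm_monoid_add"
  assumes "P 0" "\<And>e c. P (single e c)" "\<And>f g. P f \<Longrightarrow> P g \<Longrightarrow> P (f + g)"
  shows "P g"
proof -
  have "P (\<Sum>e \<in> A. single e (lookup g e))" if "finite A" for A
    using that by (induction A rule: finite_induct) (auto intro: assms)
  from this[of "keys g"] show ?thesis by (simp add: sum_singles)
qed

lemma poly_ring_simps:
  "p \<otimes>\<^bsub>poly_ring n\<^esub> q = p * q" "p \<oplus>\<^bsub>poly_ring n\<^esub> q = p + q"
  "\<one>\<^bsub>poly_ring n\<^esub> = 1" "\<zero>\<^bsub>poly_ring n\<^esub> = 0"
  by (simp_all add: poly_ring_def)

lemma poly_ring_ring: "ring (poly_ring n)"
  using poly_ring_cring by (rule cring.axioms)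

lemma carrier_add:
  "p \<in> carrier (poly_ring n) \<Longrightarrow> q \<in> carrier (poly_ring n) \<Longrightarrow> p + q \<in> carrier (poly_ring n)"
  using ring.ring_simprules(1)[OF poly_ring_ring] by (simp add: poly_ring_simps)

lemma carrier_mult:
  "p \<in> carrier (poly_ring n) \<Longrightarrow> q \<in> carrier (poly_ring n) \<Longrightarrow> p * q \<in> carrier (poly_ring n)"
  using ring.ring_simprules(5)[OF poly_ring_ring] by (simp add: poly_ring_simps)

lemma carrier_const: "single 0 c \<in> carrier (poly_ring n)"
  by (simp add: poly_ring_def)

lemma carrier_0: "0 \<in> carrier (poly_ring n)" and carrier_1: "1 \<in> carrier (poly_ring n)"
  by (simp_all add: poly_ring_def)

lemma carrier_uminus: "p \<in> carrier (poly_ring n) \<Longrightarrow> - p \<in> carrier (poly_ring n)"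
  by (simp add: poly_ring_def)

lemma carrier_diff:
  "p \<in> carrier (poly_ring n) \<Longrightarrow> q \<in> carrier (poly_ring n) \<Longrightarrow> p - q \<in> carrier (poly_ring n)"
  using carrier_add[OF _ carrier_uminus, of p n q] by simp

lemma carrier_pvar: "v \<in> vars n \<Longrightarrow> pvar v \<in> carrier (poly_ring n)"
  by (simp add: poly_ring_def pvar_def)

lemma carrier_sum:
  "(\<And>i. i \<in> A \<Longrightarrow> f i \<in> carrier (poly_ring n)) \<Longrightarrow> sum f A \<in> carrier (poly_ring n)"
  by (induction A rule: infinite_finite_induct) (auto intro: carrier_add carrier_0)

lemma carrier_prod:
  "(\<And>i. i \<in> A \<Longrightarrow> f i \<in> carrier (poly_ring n)) \<Longrightarrow> prod f A \<in> carrier (poly_ring n)"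
  by (induction A rule: infinite_finite_induct) (auto intro: carrier_mult carrier_1)

lemma carrier_power: "p \<in> carrier (poly_ring n) \<Longrightarrow> p ^ r \<in> carrier (poly_ring n)"
  by (induction r) (auto intro: carrier_mult carrier_1)

lemma ideal_poly_ringI:
  assumes "T \<subseteq> carrier (poly_ring n)" "0 \<in> T" "\<And>p q. p \<in> T \<Longrightarrow> q \<in> T \<Longrightarrow> p + q \<in> T"
    and mult: "\<And>p q. p \<in> carrier (poly_ring n) \<Longrightarrow> q \<in> T \<Longrightarrow> p * q \<in> T"
  shows "ideal T (poly_ring n)"
proof -
  interpret ring "poly_ring n" by (rule poly_ring_ring)
  have "inv\<^bsub>add_monoid (poly_ring n)\<^esub> p \<in> T" if "p \<in> T" for p
  proof -
    have "- 1 * p \<in> T"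
      using that by (intro mult carrier_uminus carrier_1)
    moreover have "\<ominus>\<^bsub>poly_ring n\<^esub> p = - p"
      using that assms(1) by (intro minus_equality) (auto simp: poly_ring_simps intro: carrier_uminus)
    ultimately show ?thesis by (simp add: a_inv_def)
  qed
  then have "subgroup T (add_monoid (poly_ring n))"
    using assms by (intro subgroup.intro) (auto simp: poly_ring_simps)
  moreover have "q * p \<in> T" if "p \<in> carrier (poly_ring n)" "q \<in> T" for p q
    using mult[OF that] by (simp add: mult.commute)
  ultimately show ?thesis
    using mult by (intro idealI poly_ring_ring) (simp_all add: poly_ring_simps)
qed

lemma ideal_poly_ring_closed:
  assumes "ideal T (poly_ring n)"
  shows "T \<subseteq> carrier (poly_ring n)" "0 \<in> T" "p \<in> T \<Longrightarrow> q \<in> T \<Longrightarrow> p + q \<in> T"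
    "q \<in> T \<Longrightarrow> p \<in> carrier (poly_ring n) \<Longrightarrow> p * q \<in> T"
proof -
  interpret ideal T "poly_ring n" by fact
  show "T \<subseteq> carrier (poly_ring n)" by (rule a_subset)
  show "0 \<in> T" using additive_subgroup.zero_closed[OF is_additive_subgroup] by (simp add: poly_ring_simps)
  show "p + q \<in> T" if "p \<in> T" "q \<in> T" using additive_subgroup.a_closed[OF is_additive_subgroup that] by (simp add: poly_ring_simps)
  show "p * q \<in> T" if "q \<in> T" "p \<in> carrier (poly_ring n)"
    using I_l_closed[OF that] by (simp add: poly_ring_simps)
qed

lemma ideal_pow_simps:
  "T [^]\<^bsub>ideals_set (poly_ring n)\<^esub> (0::nat) = carrier (poly_ring n)"
  "T [^]\<^bsub>ideals_set (poly_ring n)\<^esub> Suc d = ideal_prod (poly_ring n) (T [^]\<^bsub>ideals_set (poly_ring n)\<^esub> d) T"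
  by (simp_all add: ideals_set_def)

lemma ideal_pow:
  fixes d :: nat
  assumes "ideal T (poly_ring n)"
  shows "ideal (T [^]\<^bsub>ideals_set (poly_ring n)\<^esub> d) (poly_ring n)"
proof (induction d)
  case 0
  show ?case unfolding ideal_pow_simps by (rule ring.oneideal[OF poly_ring_ring])
next
  case (Suc d)
  then show ?case unfolding ideal_pow_simps
    by (rule ring.ideal_prod_is_ideal[OF poly_ring_ring _ assms])
qed

lemma ideal_Idl:
  "S \<subseteq> carrier (poly_ring n) \<Longrightarrow> ideal (Idl\<^bsub>poly_ring n\<^esub> S) (poly_ring n)"
  by (rule ring.genideal_ideal[OF poly_ring_ring])

lemma ideal_carrier_Inter:
  assumes "\<And>i. i \<in> A \<Longrightarrow> ideal (F i) (poly_ring n)"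
  shows "ideal (carrier (poly_ring n) \<inter> (\<Inter>i \<in> A. F i)) (poly_ring n)"
  by (rule ideal_poly_ringI)
    (auto intro: carrier_0 carrier_add carrier_mult ideal_poly_ring_closed(2,3,4)[OF assms])

lemma ideal_J: "ideal (ideal_J n) (poly_ring n)"
  unfolding ideal_J_def
  by (rule ideal_carrier_Inter) (auto simp: vars_def intro!: ideal_Idl carrier_diff carrier_pvar)

lemma ideal_I: "ideal (ideal_I n) (poly_ring n)"
  unfolding ideal_I_def
  by (rule ideal_carrier_Inter) (auto simp: vars_def intro!: ideal_Idl carrier_diff carrier_pvar)

section \<open>Detecting powers of the ideal of a diagonal\<close>

text \<open>
  Membership in a power of the ideal \<open>(u - u', v - v')\<close> is tested against linear functionals. A weight on
  monomials defines a functional on polynomials, and multiplying a polynomial by \<open>u - u'\<close> amounts to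
  replacing the weight by its difference in the direction from \<open>u'\<close> to \<open>u\<close>. Weights that all
  \<open>d\<close>-fold differences annihilate therefore kill the \<open>d\<close>-th power of the ideal. Such weights play the part
  of differential operators of order below \<open>d\<close> followed by restriction to the diagonal
  \<open>u = u'\<close>, \<open>v = v'\<close>, and evaluating them takes the coefficients only.
\<close>

definition pairing :: "cpoly \<Rightarrow> (expo \<Rightarrow> complex) \<Rightarrow> complex" where
  "pairing g w = (\<Sum>e \<in> keys g. lookup g e * w e)"

lemma pairing_superset:
  "finite S \<Longrightarrow> keys g \<subseteq> S \<Longrightarrow> pairing g w = (\<Sum>e \<in> S. lookup g e * w e)"
  unfolding pairing_def by (intro sum.mono_neutral_left) (auto simp: in_keys_iff)

lemma pairing_0: "pairing 0 w = 0"
  by (simp add: pairing_def)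

lemma pairing_add: "pairing (f + g) w = pairing f w + pairing g w"
proof -
  let ?S = "keys f \<union> keys g"
  have "keys (f + g) \<subseteq> ?S" by (rule Poly_Mapping.keys_add)
  then show ?thesis
    by (simp add: pairing_superset[of ?S] lookup_add distrib_right sum.distrib)
qed

lemma pairing_single_mult:
  "pairing (single s c * g) w = c * pairing g (\<lambda>e. w (s + e))"
proof (induction g rule: poly_single_add_induct)
  case (single e c')
  have "pairing (single e c) w = c * w e" for e c and w :: "expo \<Rightarrow> complex"
    using pairing_superset[of "{e}" "single e c" w] by auto
  then show ?case by (simp add: mult_single)
qed (simp_all add: pairing_0 pairing_add distrib_left)

primrec test_functions :: "var \<Rightarrow> var \<Rightarrow> var \<Rightarrow> var \<Rightarrow> nat \<Rightarrow> (expo \<Rightarrow> complex) set" where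
  "test_functions u u' v v' 0 = {\<lambda>_. 0}"
| "test_functions u u' v v' (Suc d) =
     {w. (\<lambda>e. w (single u 1 + e) - w (single u' 1 + e)) \<in> test_functions u u' v v' d \<and>
         (\<lambda>e. w (single v 1 + e) - w (single v' 1 + e)) \<in> test_functions u u' v v' d}"

lemma test_functions_swap: "test_functions u u' v v' d = test_functions v v' u u' d"
  by (induction d) auto

lemma test_functions_shift: "w \<in> test_functions u u' v v' d \<Longrightarrow> (\<lambda>e. w (s + e)) \<in> test_functions u u' v v' d"
proof (induction d arbitrary: w)
  case (Suc d)
  have "(\<lambda>e. w (s + (single u 1 + e)) - w (s + (single u' 1 + e))) \<in> test_functions u u' v v' d"
    "(\<lambda>e. w (s + (single v 1 + e)) - w (s + (single v' 1 + e))) \<in> test_functions u u' v v' d"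
    using Suc.prems Suc.IH[of "\<lambda>e. w (single u 1 + e) - w (single u' 1 + e)"]
      Suc.IH[of "\<lambda>e. w (single v 1 + e) - w (single v' 1 + e)"]
    by (simp_all add: add.left_commute)
  then show ?case by simp
qed auto

lemma test_functions_add:
  "w \<in> test_functions u u' v v' d \<Longrightarrow> w' \<in> test_functions u u' v v' d \<Longrightarrow> (\<lambda>e. w e + w' e) \<in> test_functions u u' v v' d"
proof (induction d arbitrary: w w')
  case (Suc d)
  have "(\<lambda>e. (w (s + e) - w (s' + e)) + (w' (s + e) - w' (s' + e))) =
      (\<lambda>e. (w (s + e) + w' (s + e)) - (w (s' + e) + w' (s' + e)))" for s s'
    by auto
  then show ?case
    using Suc.prems Suc.IH[of "\<lambda>e. w (single u 1 + e) - w (single u' 1 + e)"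
        "\<lambda>e. w' (single u 1 + e) - w' (single u' 1 + e)"]
      Suc.IH[of "\<lambda>e. w (single v 1 + e) - w (single v' 1 + e)"
        "\<lambda>e. w' (single v 1 + e) - w' (single v' 1 + e)"]
    by simp
qed auto

lemma test_functions_zero: "(\<lambda>_. 0) \<in> test_functions u u' v v' d"
  by (induction d) auto

text \<open>
  Discrete Leibniz rule: differencing \<open>(u - c) w\<close> either lowers the degree of \<open>w\<close> or replaces the
  linear factor by a shift of \<open>w\<close>. Hence a product of \<open>r\<close> linear factors behaves like a polynomial of
  degree \<open>r\<close>.
\<close>

lemma test_functions_mult_linear:
  assumes dist: "u \<notin> {u', v, v'}" and w: "w \<in> test_functions u u' v v' d"
  shows "(\<lambda>e. (of_nat (lookup e u) - c) * w e) \<in> test_functions u u' v v' (Suc d)"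
  using w
proof (induction d arbitrary: w)
  case 0
  then show ?case by simp
next
  case (Suc d)
  let ?D = "\<lambda>s s' e. w (single s 1 + e) - w (single s' 1 + e)"
  have D: "?D u u' \<in> test_functions u u' v v' d" "?D v v' \<in> test_functions u u' v v' d"
    using Suc.prems by auto
  have "(\<lambda>e. (of_nat (lookup (single u 1 + e) u) - c) * w (single u 1 + e)
          - (of_nat (lookup (single u' 1 + e) u) - c) * w (single u' 1 + e))
      = (\<lambda>e. (of_nat (lookup e u) - c) * ?D u u' e + w (single u 1 + e))"
    using dist by (auto simp: lookup_add lookup_single algebra_simps)
  moreover have "\<dots> \<in> test_functions u u' v v' (Suc d)"
    using Suc.IH[OF D(1)] test_functions_shift[OF Suc.prems] by (rule test_functions_add)
  moreover have "(\<lambda>e. (of_nat (lookup (single v 1 + e) u) - c) * w (single v 1 + e)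
          - (of_nat (lookup (single v' 1 + e) u) - c) * w (single v' 1 + e))
      = (\<lambda>e. (of_nat (lookup e u) - c) * ?D v v' e)"
    using dist by (auto simp: lookup_add lookup_single algebra_simps)
  moreover have "\<dots> \<in> test_functions u u' v v' (Suc d)"
    by (rule Suc.IH[OF D(2)])
  ultimately show ?case
    by (subst test_functions.simps) (simp only: mem_Collect_eq)
qed

lemma test_functions_mult_prod:
  assumes dist: "u \<notin> {u', v, v'}" and w: "w \<in> test_functions u u' v v' d" and "finite C"
  shows "(\<lambda>e. (\<Prod>c \<in> C. of_nat (lookup e u) - of_nat c) * w e) \<in> test_functions u u' v v' (card C + d)"
  using \<open>finite C\<close>
proof (induction C rule: finite_induct)
  case empty
  then show ?case using w by simp
next
  case (insert c C)
  show ?case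
    using test_functions_mult_linear[OF dist insert.IH, of "of_nat c"] insert.hyps
    by (simp add: mult.assoc)
qed

definition order_ge :: "var \<Rightarrow> var \<Rightarrow> var \<Rightarrow> var \<Rightarrow> nat \<Rightarrow> cpoly set" where
  "order_ge u u' v v' d = {g. \<forall>w \<in> test_functions u u' v v' d. pairing g w = 0}"

lemma order_ge_add:
  "f \<in> order_ge u u' v v' d \<Longrightarrow> g \<in> order_ge u u' v v' d \<Longrightarrow> f + g \<in> order_ge u u' v v' d"
  by (simp add: order_ge_def pairing_add)

lemma order_ge_mult: "g \<in> order_ge u u' v v' d \<Longrightarrow> p * g \<in> order_ge u u' v v' d"
proof (induction p rule: poly_single_add_induct)
  case (single e c)
  then show ?case by (auto simp: order_ge_def pairing_single_mult intro!: test_functions_shift)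
qed (auto simp: order_ge_def pairing_0 pairing_add distrib_right)

lemma order_ge_mult_generator:
  assumes "g \<in> order_ge u u' v v' d" "(z, z') \<in> {(u, u'), (v, v')}"
  shows "(pvar z - pvar z') * g \<in> order_ge u u' v v' (Suc d)"
proof -
  have eq: "(pvar z - pvar z') * g = single (single z 1) 1 * g + single (single z' 1) (- 1) * g"
    by (simp add: pvar_def left_diff_distrib single_uminus)
  have add: "pairing g w + pairing g (\<lambda>e. - w' e) = pairing g (\<lambda>e. w e - w' e)" for w w'
    by (simp add: pairing_def sum.distrib[symmetric] algebra_simps flip: sum_subtractf)
  have neg: "- pairing g w = pairing g (\<lambda>e. - w e)" for w
    by (simp add: pairing_def flip: sum_negf)
  have "pairing ((pvar z - pvar z') * g) w =
      pairing g (\<lambda>e. w (single z 1 + e) - w (single z' 1 + e))" for w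
    by (simp add: eq pairing_add pairing_single_mult neg add)
  then show ?thesis using assms by (auto simp: order_ge_def)
qed

text \<open>
  The multipliers that raise the vanishing order by one form an ideal, so the two generators decide.
\<close>

lemma order_ge_mult_ideal:
  assumes p: "p \<in> Idl\<^bsub>poly_ring n\<^esub> {pvar u - pvar u', pvar v - pvar v'}"
    and "{u, u', v, v'} \<subseteq> vars n" "g \<in> order_ge u u' v v' d"
  shows "g * p \<in> order_ge u u' v v' (Suc d)"
proof -
  let ?G = "{pvar u - pvar u', pvar v - pvar v'}"
  let ?T = "{p \<in> carrier (poly_ring n).
      \<forall>d. \<forall>g \<in> order_ge u u' v v' d. p * g \<in> order_ge u u' v v' (Suc d)}"
  have 0: "0 \<in> order_ge u u' v v' d" for d by (simp add: order_ge_def pairing_0)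
  have "ideal ?T (poly_ring n)"
    by (rule ideal_poly_ringI)
      (auto simp: distrib_right mult.assoc 0 intro: carrier_0 carrier_add carrier_mult order_ge_add order_ge_mult)
  moreover have "?G \<subseteq> ?T"
    using assms(2) by (auto intro: order_ge_mult_generator carrier_diff carrier_pvar)
  ultimately have "Idl\<^bsub>poly_ring n\<^esub> ?G \<subseteq> ?T"
    by (rule ring.genideal_minimal[OF poly_ring_ring])
  then show ?thesis using p assms(3) by (auto simp: mult.commute)
qed

lemma ideal_pow_order_ge:
  fixes d :: nat
  assumes T: "T \<subseteq> Idl\<^bsub>poly_ring n\<^esub> {pvar u - pvar u', pvar v - pvar v'}"
    and vars: "{u, u', v, v'} \<subseteq> vars n"
    and "g \<in> T [^]\<^bsub>ideals_set (poly_ring n)\<^esub> d"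
  shows "g \<in> order_ge u u' v v' d"
  using \<open>g \<in> _\<close>
proof (induction d arbitrary: g)
  case 0
  then show ?case by (simp add: order_ge_def pairing_def)
next
  case (Suc d)
  from Suc.prems show ?case unfolding ideal_pow_simps
  proof (induction g rule: ideal_prod.induct)
    case (prod i j)
    then show ?case
      using Suc.IH T order_ge_mult_ideal[OF _ vars] by (auto simp: poly_ring_simps)
  next
    case (sum s1 s2)
    then show ?case by (simp add: poly_ring_simps order_ge_add)
  qed
qed

text \<open>
  This lemma yields every lower bound on exponents. Multiplication by \<open>u - u'\<close> or \<open>v - v'\<close> couples only
  monomials in one fiber, where the total degrees in \<open>{u, u'}\<close> and in \<open>{v, v'}\<close> and all other exponents are
  fixed. If every monomial of the fiber other than \<open>e0\<close> has its \<open>u\<close>-exponent in \<open>C\<close> or its \<open>v\<close>-exponent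
  in \<open>C'\<close>, while \<open>e0\<close> has neither, then the product of the linear factors vanishing on \<open>C\<close> and \<open>C'\<close> isolates the
  coefficient of \<open>e0\<close>, and this product is an admissible weight as soon as its degree is below \<open>d\<close>.
\<close>

lemma order_ge_corner:
  assumes g: "g \<in> order_ge u u' v v' d" and dist: "distinct [u, u', v, v']"
    and e0: "e0 \<in> keys g" and fin: "finite C" "finite C'"
    and nin: "lookup e0 u \<notin> C" "lookup e0 v \<notin> C'"
    and fiber: "\<And>e. e \<in> keys g \<Longrightarrow> e \<noteq> e0 \<Longrightarrow> (\<And>z. z \<notin> {u, u', v, v'} \<Longrightarrow> lookup e z = lookup e0 z) \<Longrightarrow>
      lookup e u + lookup e u' = lookup e0 u + lookup e0 u' \<Longrightarrow>
      lookup e v + lookup e v' = lookup e0 v + lookup e0 v' \<Longrightarrow> lookup e u \<in> C \<or> lookup e v \<in> C'"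
  shows "d \<le> card C + card C'"
proof (rule ccontr)
  assume less: "\<not> d \<le> card C + card C'"
  define fib where "fib e \<longleftrightarrow> (\<forall>z. z \<notin> {u, u', v, v'} \<longrightarrow> lookup e z = lookup e0 z) \<and>
      lookup e u + lookup e u' = lookup e0 u + lookup e0 u' \<and>
      lookup e v + lookup e v' = lookup e0 v + lookup e0 v'" for e :: expo
  define w where "w e = (\<Prod>c \<in> C. of_nat (lookup e u) - of_nat c) *
      ((\<Prod>c \<in> C'. of_nat (lookup e v) - of_nat c) * (if fib e then 1 else 0 :: complex))" for e
  \<comment> \<open>The indicator of a fiber has vanishing differences, so it behaves like a constant.\<close>
  have "fib (single u 1 + e) = fib (single u' 1 + e)" "fib (single v 1 + e) = fib (single v' 1 + e)" for e
    using dist by (auto simp: fib_def lookup_add lookup_single)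
  then have "(\<lambda>e. if fib e then 1 else 0) \<in> test_functions u u' v v' (d - card C - card C')"
    using less by (cases "d - card C - card C'") (auto simp: test_functions_zero)
  then have "(\<lambda>e. (\<Prod>c \<in> C'. of_nat (lookup e v) - of_nat c) * (if fib e then 1 else 0))
      \<in> test_functions u u' v v' (card C' + (d - card C - card C'))"
    using dist fin unfolding test_functions_swap[of u] by (intro test_functions_mult_prod) auto
  then have "w \<in> test_functions u u' v v' (card C + (card C' + (d - card C - card C')))"
    unfolding w_def[abs_def] using dist fin by (intro test_functions_mult_prod) auto
  then have "w \<in> test_functions u u' v v' d" using less by simp
  then have "0 = pairing g w" using g by (simp add: order_ge_def)
  also have "\<dots> = (\<Sum>e \<in> keys g. if e = e0 then lookup g e * w e else 0)"
    unfolding pairing_def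
  proof (intro sum.cong refl)
    fix e assume "e \<in> keys g"
    moreover have "w e = 0" if "lookup e u \<in> C \<or> lookup e v \<in> C' \<or> \<not> fib e"
      using that fin by (auto simp: w_def)
    ultimately show "lookup g e * w e = (if e = e0 then lookup g e * w e else 0)"
      using fiber[of e] by (auto simp: fib_def)
  qed
  also have "\<dots> = lookup g e0 * w e0"
    using e0 by (simp add: sum.delta)
  finally have "w e0 = 0" using e0 by (simp add: in_keys_iff)
  then show False using nin fin by (auto simp: w_def fib_def)
qed

section \<open>The lexicographic order\<close>

definition vlist :: "nat \<Rightarrow> var list" where
  "vlist n = [X, Y] @ map Xi [1..<Suc n] @ map Yi [1..<Suc n]"

lemma set_vlist: "set (vlist n) = vars n"
  by (auto simp: vlist_def vars_def)

lemma expo_vec_vlist: "expo_vec n e = map (\<lambda>z. int (lookup e z)) (vlist n)"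
  by (simp add: expo_vec_def exp_vec_def vlist_def)

lemma exp_vec_eq_expo_vec_iff:
  "exp_vec n a b as bs = expo_vec n e \<longleftrightarrow>
     a = int (lookup e X) \<and> b = int (lookup e Y) \<and>
     (\<forall>i \<in> {1..n}. as i = int (lookup e (Xi i)) \<and> bs i = int (lookup e (Yi i)))"
proof -
  have "xs @ ys = xs' @ ys' \<longleftrightarrow> xs = xs' \<and> ys = ys'" if "length xs = length xs'"
    for xs xs' ys ys' :: "int list"
    using that by simp
  then show ?thesis
    by (auto simp: expo_vec_def exp_vec_def simp del: upt_Suc)
qed

definition prec :: "nat \<Rightarrow> expo \<Rightarrow> expo \<Rightarrow> bool" where
  "prec n e f \<longleftrightarrow> (expo_vec n e, expo_vec n f) \<in> lexord {(s, t). s < t}"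

lemma prec_at:
  assumes "vlist n = us @ z # vs" "\<forall>y \<in> set us. lookup e y = lookup f y"
  shows "lookup e z < lookup f z \<Longrightarrow> prec n e f" and "prec n e f \<Longrightarrow> lookup e z \<le> lookup f z"
proof -
  have "map (\<lambda>z. int (lookup e z)) us = map (\<lambda>z. int (lookup f z)) us"
    using assms(2) by simp
  then have "prec n e f \<longleftrightarrow> (int (lookup e z) # map (\<lambda>z. int (lookup e z)) vs,
      int (lookup f z) # map (\<lambda>z. int (lookup f z)) vs) \<in> lexord {(s, t). s < t}"
    by (simp only: prec_def expo_vec_vlist assms(1) map_append list.map lexord_same_pref_iff) simp
  then show "lookup e z < lookup f z \<Longrightarrow> prec n e f" "prec n e f \<Longrightarrow> lookup e z \<le> lookup f z"
    by auto
qed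

text \<open>
  The prefix of the variable list in front of \<open>Xi i\<close> or \<open>Yi i\<close>, in the form that the comparison of exponents
  at one position takes it.
\<close>

lemma vlist_split:
  assumes "i \<in> {1..n}"
  shows "vlist n = ([X, Y] @ map Xi [1..<i]) @ Xi i # (map Xi [Suc i..<Suc n] @ map Yi [1..<Suc n])"
    and "vlist n = ([X, Y] @ map Xi [1..<Suc n] @ map Yi [1..<i]) @ Yi i # map Yi [Suc i..<Suc n]"
proof -
  have "[1..<Suc n] = [1..<i] @ i # [Suc i..<Suc n]"
    using assms upt_add_eq_append[of 1 i "Suc n - i"] by (simp add: upt_conv_Cons del: upt_Suc)
  then show "vlist n = ([X, Y] @ map Xi [1..<i]) @ Xi i # (map Xi [Suc i..<Suc n] @ map Yi [1..<Suc n])"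
    "vlist n = ([X, Y] @ map Xi [1..<Suc n] @ map Yi [1..<i]) @ Yi i # map Yi [Suc i..<Suc n]"
    by (simp_all add: vlist_def del: upt_Suc)
qed

section \<open>Permuting the points\<close>

lemma lookup_perm_poly:
  "bij \<sigma> \<Longrightarrow> lookup (perm_poly \<sigma> p) e = lookup p (Poly_Mapping.map_key (perm_var \<sigma>) e)"
  by (simp add: perm_poly_def map_key.rep_eq inj_map_key_perm_var)

lemma lookup_map_key_perm_var:
  "bij \<sigma> \<Longrightarrow> lookup (Poly_Mapping.map_key (perm_var \<sigma>) e) z = lookup e (perm_var \<sigma> z)"
  by (simp add: map_key.rep_eq bij_is_inj perm_var_bij)

section \<open>Constraints on trailing terms\<close>

text \<open>
  Only the consequences of membership in \<open>H0\<close> that bound exponents are retained: the vanishing conditions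
  along the diagonals and the symmetry, for a polynomial with trailing exponent \<open>e0\<close>.
\<close>

locale trailing_section =
  fixes n d k :: nat and g :: cpoly and e0 :: expo
  assumes key: "e0 \<in> keys g"
    and minimal: "\<And>e. e \<in> keys g \<Longrightarrow> e = e0 \<or> prec n e0 e"
    and orderJ: "\<And>i j. 1 \<le> i \<Longrightarrow> i < j \<Longrightarrow> j \<le> n \<Longrightarrow> g \<in> order_ge (Xi i) (Xi j) (Yi i) (Yi j) d"
    and orderI: "\<And>i. i \<in> {1..n} \<Longrightarrow> g \<in> order_ge (Xi i) X (Yi i) Y k"
    and sym: "\<And>\<sigma>. \<sigma> permutes {1..n} \<Longrightarrow> perm_poly \<sigma> g = of_int (sgn_char d \<sigma>) * g"
begin

lemma min_at:
  "e \<in> keys g \<Longrightarrow> vlist n = us @ z # vs \<Longrightarrow> \<forall>y \<in> set us. lookup e y = lookup e0 y \<Longrightarrow>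
     lookup e0 z \<le> lookup e z"
  using minimal[of e] prec_at(2)[of n us z vs e0 e] by auto

text \<open>
  The symmetry acts on the set of exponents: swapping two of the points changes \<open>g\<close> at most by a sign.
\<close>

lemma swap_key:
  assumes "e \<in> keys g" and ij: "i \<in> {1..n}" "j \<in> {1..n}"
  obtains e' where "e' \<in> keys g" "\<And>z. lookup e' z = lookup e (perm_var (transpose i j) z)"
proof
  let ?\<sigma> = "transpose i j" and ?f = "Poly_Mapping.map_key (perm_var (transpose i j)) :: expo \<Rightarrow> expo"
  have \<sigma>: "?\<sigma> permutes {1..n}" using ij by (rule permutes_swap_id)
  have bij: "bij ?\<sigma>" by simp
  show eq: "lookup (?f e) z = lookup e (perm_var ?\<sigma> z)" for z
    by (rule lookup_map_key_perm_var[OF bij])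
  have inv: "?f (?f e) = e"
  proof (rule poly_mapping_eqI)
    show "lookup (?f (?f e)) z = lookup e z" for z
      by (cases z) (simp_all add: lookup_map_key_perm_var)
  qed
  have "perm_poly ?\<sigma> g = g \<or> perm_poly ?\<sigma> g = - g"
    using sym[OF \<sigma>] by (auto simp: sgn_char_def sign_def split: if_splits)
  then have "lookup (perm_poly ?\<sigma> g) (?f e) = lookup g (?f e) \<or>
      lookup (perm_poly ?\<sigma> g) (?f e) = - lookup g (?f e)"
    by auto
  then show "?f e \<in> keys g"
    using \<open>e \<in> keys g\<close> unfolding lookup_perm_poly[OF bij] inv by (auto simp: in_keys_iff)
qed

lemma min_X: "e \<in> keys g \<Longrightarrow> lookup e0 X \<le> lookup e X"
  by (rule min_at[of _ "[]"]) (simp_all add: vlist_def)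

lemma min_Y: "e \<in> keys g \<Longrightarrow> lookup e X = lookup e0 X \<Longrightarrow> lookup e0 Y \<le> lookup e Y"
  by (rule min_at[of _ "[X]"]) (simp_all add: vlist_def)

text \<open>
  For \<open>j = i\<close> this is minimality of \<open>e0\<close>. The bound for later \<open>j\<close> comes from swapping the points \<open>i\<close> and \<open>j\<close>;
  this is what makes the differences \<open>a\<^sub>j - a\<^sub>i\<close>, and not \<open>a\<^sub>j\<close> itself, enter the final bound.
\<close>

lemma min_Xi:
  assumes e: "e \<in> keys g" "lookup e X = lookup e0 X" "lookup e Y = lookup e0 Y"
    "\<And>l. l \<in> {1..<i} \<Longrightarrow> lookup e (Xi l) = lookup e0 (Xi l)" and ij: "1 \<le> i" "i \<le> j" "j \<le> n"
  shows "lookup e0 (Xi i) \<le> lookup e (Xi j)"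
proof -
  obtain e' where e': "e' \<in> keys g" "\<And>z. lookup e' z = lookup e (perm_var (transpose i j) z)"
    using swap_key[of e i j] e ij by auto
  have "lookup e' (Xi l) = lookup e0 (Xi l)" if "l \<in> {1..<i}" for l
    using that ij e by (simp add: e'(2) transpose_apply_other)
  then have "\<forall>y \<in> set ([X, Y] @ map Xi [1..<i]). lookup e' y = lookup e0 y"
    using e by (auto simp: e'(2))
  then have "lookup e0 (Xi i) \<le> lookup e' (Xi i)"
    using ij by (intro min_at[OF e'(1) vlist_split(1)]) auto
  then show ?thesis by (simp add: e'(2))
qed

lemma min_Yi:
  assumes e: "e \<in> keys g" "lookup e X = lookup e0 X" "lookup e Y = lookup e0 Y"
    "\<And>l. l \<in> {1..n} \<Longrightarrow> lookup e (Xi l) = lookup e0 (Xi l)"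
    "\<And>l. l \<in> {1..<i} \<Longrightarrow> lookup e (Yi l) = lookup e0 (Yi l)" and i: "i \<in> {1..n}"
  shows "lookup e0 (Yi i) \<le> lookup e (Yi i)"
  by (rule min_at[OF e(1) vlist_split(2)[OF i]]) (use e in auto)

lemma as_mono: "1 \<le> i \<Longrightarrow> i \<le> j \<Longrightarrow> j \<le> n \<Longrightarrow> lookup e0 (Xi i) \<le> lookup e0 (Xi j)"
  by (rule min_Xi) (auto simp: key)

lemma min_Yi_tie:
  assumes e: "e \<in> keys g" "lookup e X = lookup e0 X" "lookup e Y = lookup e0 Y"
    "\<And>l. l \<in> {1..n} \<Longrightarrow> lookup e (Xi l) = lookup e0 (Xi l)"
    "\<And>l. l \<in> {1..<i} \<Longrightarrow> lookup e (Yi l) = lookup e0 (Yi l)"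
    and ij: "1 \<le> i" "i \<le> j" "j \<le> n" and tie: "lookup e0 (Xi i) = lookup e0 (Xi j)"
  shows "lookup e0 (Yi i) \<le> lookup e (Yi j)"
proof -
  obtain e' where e': "e' \<in> keys g" "\<And>z. lookup e' z = lookup e (perm_var (transpose i j) z)"
    using swap_key[of e i j] e ij by auto
  have "lookup e' (Xi l) = lookup e0 (Xi l)" if "l \<in> {1..n}" for l
    using that ij e(4) tie by (auto simp: e'(2) transpose_def)
  moreover have "lookup e' (Yi l) = lookup e0 (Yi l)" if "l \<in> {1..<i}" for l
    using that ij e by (simp add: e'(2) transpose_apply_other)
  ultimately have "lookup e0 (Yi i) \<le> lookup e' (Yi i)"
    using e ij by (intro min_Yi[OF e'(1)]) (auto simp: e'(2))
  then show ?thesis by (simp add: e'(2))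
qed

text \<open>
  In the fiber of \<open>e0\<close> for the pair \<open>i, j\<close> both \<open>x\<close>-exponents are at least their common value \<open>a\<^sub>i = a\<^sub>j\<close>, hence
  constant, and both \<open>y\<close>-exponents are at least \<open>b\<^sub>i\<close>. So \<open>e0\<close> is one end of a segment with \<open>b\<^sub>j - b\<^sub>i\<close>
  further points, which a polynomial of degree \<open>b\<^sub>j - b\<^sub>i\<close> separates from \<open>e0\<close>.
\<close>

lemma tie_gap:
  assumes ij: "1 \<le> i" "i < j" "j \<le> n" and tie: "lookup e0 (Xi i) = lookup e0 (Xi j)"
  shows "lookup e0 (Yi i) + d \<le> lookup e0 (Yi j)"
proof -
  have le: "lookup e0 (Yi i) \<le> lookup e0 (Yi j)"
    by (rule min_Yi_tie) (use ij tie key in auto)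
  have "d \<le> card ({} :: nat set) + card {lookup e0 (Yi i)<..lookup e0 (Yi j)}"
  proof (rule order_ge_corner[OF orderJ[OF ij] _ key])
    fix e assume e: "e \<in> keys g" "e \<noteq> e0"
      "\<And>z. z \<notin> {Xi i, Xi j, Yi i, Yi j} \<Longrightarrow> lookup e z = lookup e0 z"
      "lookup e (Xi i) + lookup e (Xi j) = lookup e0 (Xi i) + lookup e0 (Xi j)"
      "lookup e (Yi i) + lookup e (Yi j) = lookup e0 (Yi i) + lookup e0 (Yi j)"
    have "lookup e0 (Xi i) \<le> lookup e (Xi i)" "lookup e0 (Xi i) \<le> lookup e (Xi j)"
      using e ij by (auto intro!: min_Xi)
    then have x: "lookup e (Xi l) = lookup e0 (Xi l)" for l
      using e(3)[of "Xi l"] e(4) tie by (cases "l \<in> {i, j}") auto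
    have y: "lookup e0 (Yi i) \<le> lookup e (Yi i)"
      by (rule min_Yi) (use e x ij in auto)
    have y': "lookup e0 (Yi i) \<le> lookup e (Yi j)"
      by (rule min_Yi_tie) (use e x ij tie in auto)
    have "lookup e (Yi i) \<noteq> lookup e0 (Yi i)"
    proof
      assume "lookup e (Yi i) = lookup e0 (Yi i)"
      then have "lookup e z = lookup e0 z" for z
        using e(3)[of z] e(5) x by (cases "z \<in> {Xi i, Xi j, Yi i, Yi j}") auto
      then show False using e(2) poly_mapping_eqI by blast
    qed
    then show "lookup e (Xi i) \<in> {} \<or> lookup e (Yi i) \<in> {lookup e0 (Yi i)<..lookup e0 (Yi j)}"
      using y y' e(5) by auto
  qed (use ij in auto)
  then show ?thesis using le by simp
qed

text \<open>
  The diagonal here joins the point \<open>j\<close> to the extra point. Since the exponents of \<open>X\<close> and then of \<open>Y\<close> are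
  already minimal, those of \<open>Xi j\<close> and \<open>Yi j\<close> are maximal in the fiber.
\<close>

lemma Yi_bound_I:
  assumes e: "e \<in> keys g" "lookup e X = lookup e0 X" "lookup e Y = lookup e0 Y"
    and j: "j \<in> {1..n}" and Xj: "lookup e (Xi j) = lookup e0 (Xi j)"
  shows "k \<le> lookup e0 (Xi j) + lookup e (Yi j)"
proof -
  have "k \<le> card {..<lookup e0 (Xi j)} + card {..<lookup e (Yi j)}"
  proof (rule order_ge_corner[OF orderI[OF j] _ e(1)])
    fix e' assume e': "e' \<in> keys g" "e' \<noteq> e"
      "\<And>z. z \<notin> {Xi j, X, Yi j, Y} \<Longrightarrow> lookup e' z = lookup e z"
      "lookup e' (Xi j) + lookup e' X = lookup e (Xi j) + lookup e X"
      "lookup e' (Yi j) + lookup e' Y = lookup e (Yi j) + lookup e Y"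
    show "lookup e' (Xi j) \<in> {..<lookup e0 (Xi j)} \<or> lookup e' (Yi j) \<in> {..<lookup e (Yi j)}"
    proof (rule ccontr)
      assume neg: "\<not> ?thesis"
      then have "lookup e' X = lookup e0 X" "lookup e' (Xi j) = lookup e (Xi j)"
        using min_X[OF e'(1)] e'(4) Xj e(2) by auto
      then have "lookup e' z = lookup e z" for z
        using neg min_Y[OF e'(1)] e'(3)[of z] e'(5) e(2,3)
        by (cases "z \<in> {Xi j, X, Yi j, Y}") auto
      then show False using e'(2) poly_mapping_eqI by blast
    qed
  qed (use Xj in auto)
  then show ?thesis by simp
qed

text \<open>
  The contributions of the pairs \<open>(l, j)\<close> add up because they are collected one after the other, for all exponents
  that agree with \<open>e0\<close> up to \<open>l\<close>: once \<open>Yi j\<close> is known to have exponent at least \<open>M\<close> there, the segment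
  to be separated in the next fiber is shorter by \<open>M\<close>, and so the bound improves by the next summand. The
  statement is about all those exponents, not just \<open>e0\<close>, since each step uses the previous one for the other
  members of the fiber.
\<close>

lemma Yi_bound:
  assumes "1 \<le> i" "i \<le> j" "j \<le> n" and "e \<in> keys g" "lookup e X = lookup e0 X" "lookup e Y = lookup e0 Y"
    "\<And>l. l \<in> {1..n} \<Longrightarrow> lookup e (Xi l) = lookup e0 (Xi l)"
    "\<And>l. l \<in> {1..<i} \<Longrightarrow> lookup e (Yi l) = lookup e0 (Yi l)"
  shows "(k - lookup e0 (Xi j)) + (\<Sum>l \<in> {1..<i}. d - (lookup e0 (Xi j) - lookup e0 (Xi l))) \<le> lookup e (Yi j)"
  using assms
proof (induction i arbitrary: e rule: dec_induct)
  case base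
  then show ?case using Yi_bound_I[of e j] by simp
next
  case (step i)
  note ij = \<open>1 \<le> i\<close> \<open>Suc i \<le> j\<close> \<open>j \<le> n\<close>
  note e = \<open>e \<in> keys g\<close> \<open>lookup e X = lookup e0 X\<close> \<open>lookup e Y = lookup e0 Y\<close> step.prems(6,7)
  define M where "M = (k - lookup e0 (Xi j)) + (\<Sum>l \<in> {1..<i}. d - (lookup e0 (Xi j) - lookup e0 (Xi l)))"
  have M: "M \<le> lookup e (Yi j)"
    unfolding M_def using e ij by (intro step.IH) auto
  have le: "lookup e0 (Xi i) \<le> lookup e0 (Xi j)"
    using ij by (intro as_mono) auto
  have "d \<le> card {lookup e0 (Xi i)<..lookup e0 (Xi j)}
      + card {lookup e0 (Yi i)<..lookup e0 (Yi i) + (lookup e (Yi j) - M)}"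
  proof (rule order_ge_corner[OF orderJ _ e(1)])
    fix e' assume e': "e' \<in> keys g" "e' \<noteq> e"
      "\<And>z. z \<notin> {Xi i, Xi j, Yi i, Yi j} \<Longrightarrow> lookup e' z = lookup e z"
      "lookup e' (Xi i) + lookup e' (Xi j) = lookup e (Xi i) + lookup e (Xi j)"
      "lookup e' (Yi i) + lookup e' (Yi j) = lookup e (Yi i) + lookup e (Yi j)"
    have ei: "lookup e (Xi i) = lookup e0 (Xi i)" "lookup e (Xi j) = lookup e0 (Xi j)"
        "lookup e (Yi i) = lookup e0 (Yi i)"
      using e ij by auto
    have less: "lookup e' (Xi l) = lookup e0 (Xi l)" "lookup e' (Yi l) = lookup e0 (Yi l)"
      if "l \<in> {1..<i}" for l
      using that ij e e'(3)[of "Xi l"] e'(3)[of "Yi l"] by auto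
    have XY: "lookup e' X = lookup e0 X" "lookup e' Y = lookup e0 Y"
      using e e'(3) by auto
    have x: "lookup e0 (Xi i) \<le> lookup e' (Xi i)" "lookup e0 (Xi i) \<le> lookup e' (Xi j)"
      by (intro min_Xi; use e'(1) XY less ij in auto)+
    show "lookup e' (Xi i) \<in> {lookup e0 (Xi i)<..lookup e0 (Xi j)} \<or>
        lookup e' (Yi i) \<in> {lookup e0 (Yi i)<..lookup e0 (Yi i) + (lookup e (Yi j) - M)}"
    proof (rule ccontr)
      assume neg: "\<not> ?thesis"
      then have xeq: "lookup e' (Xi i) = lookup e (Xi i)" "lookup e' (Xi j) = lookup e (Xi j)"
        using x e'(4) ei by auto
      then have x: "lookup e' (Xi l) = lookup e0 (Xi l)" if "l \<in> {1..n}" for l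
        using that e(4) e'(3)[of "Xi l"] ei by (cases "l \<in> {i, j}") auto
      have "M \<le> lookup e' (Yi j)"
        unfolding M_def using e'(1) XY x less ij by (intro step.IH) auto
      moreover have "lookup e0 (Yi i) \<le> lookup e' (Yi i)"
        by (rule min_Yi) (use e'(1) XY x less ij in auto)
      ultimately have "lookup e' (Yi i) = lookup e (Yi i)" "lookup e' (Yi j) = lookup e (Yi j)"
        using neg e'(5) ei by auto
      then have "lookup e' z = lookup e z" for z
        using e'(3)[of z] xeq by (cases "z \<in> {Xi i, Xi j, Yi i, Yi j}") auto
      then show False using e'(2) poly_mapping_eqI by blast
    qed
  qed (use e ij in auto)
  then have "M + (d - (lookup e0 (Xi j) - lookup e0 (Xi i))) \<le> lookup e (Yi j)"
    using M le by simp
  then show ?case using ij by (simp add: M_def)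
qed

end

lemma trailing_section_H0:
  assumes g: "g \<in> H0 n m k" and tr: "is_trailing n g (exp_vec n a b as bs)"
  obtains e0 where "trailing_section n (m + k) k g e0" "exp_vec n a b as bs = expo_vec n e0"
proof -
  obtain e0 where e0: "e0 \<in> keys g" "exp_vec n a b as bs = expo_vec n e0"
    using tr by (auto simp: is_trailing_def)
  let ?J = "ideal_J n" and ?I = "ideal_I n"
  have gJ: "g \<in> ?J [^]\<^bsub>ideals_set (poly_ring n)\<^esub> (m + k)"
    and gI: "g \<in> ?I [^]\<^bsub>ideals_set (poly_ring n)\<^esub> k"
    and sym: "\<sigma> permutes {1..n} \<Longrightarrow> perm_poly \<sigma> g = of_int (sgn_char (m + k) \<sigma>) * g" for \<sigma>
    using g by (auto simp: H0_def)
  have J: "ideal ?J (poly_ring n)" by (rule ideal_J)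
  have car: "keys e \<subseteq> vars n" if "e \<in> keys g" for e
    using that ideal_poly_ring_closed(1)[OF ideal_pow[OF J, of "m + k"]] gJ by (auto simp: poly_ring_def)
  have inj: "e = e0" if "e \<in> keys g" "expo_vec n e = expo_vec n e0" for e
  proof (rule poly_mapping_eqI)
    fix z
    show "lookup e z = lookup e0 z"
    proof (cases "z \<in> vars n")
      case True
      then show ?thesis using that(2) by (simp add: expo_vec_vlist set_vlist)
    next
      case False
      then have "z \<notin> keys e" "z \<notin> keys e0" using car[OF that(1)] car[OF e0(1)] by auto
      then show ?thesis by (simp add: in_keys_iff)
    qed
  qed
  have "trailing_section n (m + k) k g e0"
  proof
    show "e0 \<in> keys g" by (rule e0)
    show "e = e0 \<or> prec n e0 e" if "e \<in> keys g" for e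
      using tr that inj[OF that] by (auto simp: is_trailing_def e0(2) prec_def)
    show "g \<in> order_ge (Xi i) (Xi j) (Yi i) (Yi j) (m + k)" if "1 \<le> i" "i < j" "j \<le> n" for i j
      using that by (intro ideal_pow_order_ge[OF _ _ gJ]) (auto simp: ideal_J_def vars_def)
    show "g \<in> order_ge (Xi i) X (Yi i) Y k" if "i \<in> {1..n}" for i
      using that by (intro ideal_pow_order_ge[OF _ _ gI]) (auto simp: ideal_I_def vars_def)
  qed (rule sym)
  then show thesis using e0 that by blast
qed

section \<open>Trailing terms of products and sums\<close>

lemma prec_trans: "prec n e f \<Longrightarrow> prec n f h \<Longrightarrow> prec n e h"
  unfolding prec_def by (erule lexord_trans) (auto simp: trans_def)

lemma prec_irrefl: "\<not> prec n e e"
  unfolding prec_def by (rule lexord_irreflexive) auto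

lemma prec_add_left: "prec n e f \<Longrightarrow> prec n (h + e) (h + f)"
proof -
  have "(map (\<lambda>z. int (lookup (h + e) z)) zs, map (\<lambda>z. int (lookup (h + f) z)) zs) \<in> lexord {(s, t). s < t}"
    if "(map (\<lambda>z. int (lookup e z)) zs, map (\<lambda>z. int (lookup f z)) zs) \<in> lexord {(s, t). s < t}" for zs
    using that by (induction zs) (auto simp: lookup_add)
  then show "prec n e f \<Longrightarrow> prec n (h + e) (h + f)"
    by (simp add: prec_def expo_vec_vlist)
qed

lemma prec_add:
  "prec n e e' \<Longrightarrow> f = f' \<or> prec n f f' \<Longrightarrow> prec n (e + f) (e' + f')"
  using prec_add_left[of n e e' f] prec_add_left[of n f f' e']
  by (auto simp: add.commute intro: prec_trans)

text \<open>
  The coefficient \<open>c\<close> may be zero: \<open>e\<close> is then only a strict lower bound for the exponents of \<open>p\<close>. This makes the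
  notion additive for fixed \<open>e\<close>.
\<close>

definition trails :: "nat \<Rightarrow> cpoly \<Rightarrow> expo \<Rightarrow> complex \<Rightarrow> bool" where
  "trails n p e c \<longleftrightarrow> (\<forall>f \<in> keys (p - single e c). prec n e f)"

lemma trails_single: "trails n (single e c) e c"
  by (simp add: trails_def)

lemma trails_0: "trails n 0 e 0" and trails_1: "trails n 1 0 1"
  using trails_single[of n e 0] trails_single[of n 0 1] by simp_all

lemma trails_lookup: "trails n p e c \<Longrightarrow> lookup p e = c"
  using prec_irrefl[of n e] by (fastforce simp: trails_def in_keys_iff lookup_minus)

lemma trails_keys: "trails n p e c \<Longrightarrow> f \<in> keys p \<Longrightarrow> f = e \<or> prec n e f"
  by (cases "f = e") (auto simp: trails_def in_keys_iff lookup_minus lookup_single)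

lemma is_trailingI:
  assumes "trails n p e c" "c \<noteq> 0"
  shows "is_trailing n p (expo_vec n e)"
  using trails_lookup[OF assms(1)] trails_keys[OF assms(1)] assms(2)
  by (fastforce simp: is_trailing_def prec_def in_keys_iff)

lemma trails_prec: "trails n p f c \<Longrightarrow> prec n e f \<Longrightarrow> trails n p e 0"
  using trails_keys[of n p f c] prec_trans[of n e f] unfolding trails_def single_zero diff_zero by blast

lemma trails_add: "trails n p e c \<Longrightarrow> trails n q e c' \<Longrightarrow> trails n (p + q) e (c + c')"
proof -
  assume *: "trails n p e c" "trails n q e c'"
  have "p + q - single e (c + c') = (p - single e c) + (q - single e c')"
    by (simp add: single_add)
  then have "keys (p + q - single e (c + c')) \<subseteq> keys (p - single e c) \<union> keys (q - single e c')"
    using Poly_Mapping.keys_add[of "p - single e c" "q - single e c'"] by (simp only:)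
  then show ?thesis using * unfolding trails_def by blast
qed

lemma trails_sum:
  "(\<And>i. i \<in> S \<Longrightarrow> trails n (f i) e (c i)) \<Longrightarrow> trails n (sum f S) e (sum c S)"
  by (induction S rule: infinite_finite_induct) (simp_all add: trails_add trails_0)

lemma trails_mult:
  assumes p: "trails n p e c" and q: "trails n q f c'"
  shows "trails n (p * q) (e + f) (c * c')"
proof -
  define p' q' where "p' = p - single e c" and "q' = q - single f c'"
  have "p * q - single (e + f) (c * c') = single e c * q' + p' * q"
    by (simp add: p'_def q'_def algebra_simps mult_single)
  moreover have "prec n (e + f) h" if h: "h \<in> keys (single e c * q')" for h
  proof -
    obtain a b where "h = a + b" "a \<in> keys (single e c)" "b \<in> keys q'"
      using h keys_mult[of "single e c" q'] by blast
    then show ?thesis using q by (auto simp: trails_def q'_def prec_add_left split: if_splits)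
  qed
  moreover have "prec n (e + f) h" if h: "h \<in> keys (p' * q)" for h
  proof -
    obtain a b where "h = a + b" "a \<in> keys p'" "b \<in> keys q"
      using h keys_mult[of p' q] by blast
    then show ?thesis using p trails_keys[OF q] by (auto simp: trails_def p'_def intro: prec_add)
  qed
  ultimately show ?thesis
    using Poly_Mapping.keys_add[of "single e c * q'" "p' * q"] by (fastforce simp: trails_def)
qed

lemma trails_prod:
  "(\<And>i. i \<in> S \<Longrightarrow> trails n (f i) (e i) (c i)) \<Longrightarrow> trails n (prod f S) (sum e S) (prod c S)"
  by (induction S rule: infinite_finite_induct) (simp_all add: trails_mult trails_1)

lemma trails_power: "trails n p (single z 1) 1 \<Longrightarrow> trails n (p ^ r) (single z r) 1"
proof (induction r)
  case 0
  then show ?case by (simp add: trails_1)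
next
  case (Suc r)
  then show ?case using trails_mult[of n p "single z 1" 1 "p ^ r" "single z r" 1]
    by (simp flip: single_add)
qed

lemma trails_pvar: "trails n (pvar z) (single z 1) 1"
  by (simp add: pvar_def trails_single)

lemma trails_diff_base:
  "trails n (pvar (Xi i) - pvar X) (single (Xi i) 1) 1"
  "trails n (pvar (Yi i) - pvar Y) (single (Yi i) 1) 1"
proof -
  have "prec n (single (Xi i) 1) (single X 1)"
    by (rule prec_at(1)[of n "[]"]) (auto simp: vlist_def lookup_single)
  then show "trails n (pvar (Xi i) - pvar X) (single (Xi i) 1) 1"
    by (simp add: trails_def pvar_def)
  have "prec n (single (Yi i) 1) (single Y 1)"
    by (rule prec_at(1)[of n "[X]"]) (auto simp: vlist_def lookup_single)
  then show "trails n (pvar (Yi i) - pvar Y) (single (Yi i) 1) 1"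
    by (simp add: trails_def pvar_def)
qed

section \<open>The action of permutations\<close>

lemma perm_poly_single:
  assumes "bij \<sigma>"
  shows "perm_poly \<sigma> (single e c) = single (Poly_Mapping.map_key (perm_var (inv_into UNIV \<sigma>)) e) c"
proof (rule poly_mapping_eqI)
  fix f :: expo
  have v: "perm_var \<sigma> (perm_var (inv_into UNIV \<sigma>) z) = z" "perm_var (inv_into UNIV \<sigma>) (perm_var \<sigma> z) = z" for z
    using assms by (cases z; simp add: bij_is_surj surj_f_inv_f bij_is_inj)+
  have "e = Poly_Mapping.map_key (perm_var \<sigma>) f \<longleftrightarrow> Poly_Mapping.map_key (perm_var (inv_into UNIV \<sigma>)) e = f"
  proof
    assume "e = Poly_Mapping.map_key (perm_var \<sigma>) f"
    then show "Poly_Mapping.map_key (perm_var (inv_into UNIV \<sigma>)) e = f"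
      using assms v by (intro poly_mapping_eqI) (simp add: lookup_map_key_perm_var bij_imp_bij_inv)
  next
    assume "Poly_Mapping.map_key (perm_var (inv_into UNIV \<sigma>)) e = f"
    then show "e = Poly_Mapping.map_key (perm_var \<sigma>) f"
      using assms v by (intro poly_mapping_eqI) (auto simp: lookup_map_key_perm_var bij_imp_bij_inv)
  qed
  then show "lookup (perm_poly \<sigma> (single e c)) f =
      lookup (single (Poly_Mapping.map_key (perm_var (inv_into UNIV \<sigma>)) e) c) f"
    by (simp add: lookup_perm_poly[OF assms] lookup_single when_def)
qed

lemma perm_poly_0: "bij \<sigma> \<Longrightarrow> perm_poly \<sigma> 0 = 0"
  by (rule poly_mapping_eqI) (simp add: lookup_perm_poly)

lemma perm_poly_add: "bij \<sigma> \<Longrightarrow> perm_poly \<sigma> (p + q) = perm_poly \<sigma> p + perm_poly \<sigma> q"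
  by (rule poly_mapping_eqI) (simp add: lookup_perm_poly lookup_add)

lemma perm_poly_diff: "bij \<sigma> \<Longrightarrow> perm_poly \<sigma> (p - q) = perm_poly \<sigma> p - perm_poly \<sigma> q"
  by (rule poly_mapping_eqI) (simp add: lookup_perm_poly lookup_minus)

lemma perm_poly_mult:
  assumes "bij \<sigma>"
  shows "perm_poly \<sigma> (p * q) = perm_poly \<sigma> p * perm_poly \<sigma> q"
proof (induction p rule: poly_single_add_induct)
  case (single e c)
  show ?case
  proof (induction q rule: poly_single_add_induct)
    case (single f c')
    show ?case
      using assms by (simp add: mult_single perm_poly_single map_key_plus bij_is_inj perm_var_bij bij_imp_bij_inv)
  qed (simp_all add: assms perm_poly_0 perm_poly_add distrib_left)
qed (simp_all add: assms perm_poly_0 perm_poly_add distrib_right)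

lemma perm_poly_of_int: "bij \<sigma> \<Longrightarrow> perm_poly \<sigma> (of_int c) = of_int c"
  by (simp add: perm_poly_single perm_var_bij bij_is_inj bij_imp_bij_inv flip: single_of_int)

lemma perm_poly_sum: "bij \<sigma> \<Longrightarrow> perm_poly \<sigma> (sum f A) = (\<Sum>i \<in> A. perm_poly \<sigma> (f i))"
  by (induction A rule: infinite_finite_induct) (simp_all add: perm_poly_0 perm_poly_add)

lemma perm_poly_prod: "bij \<sigma> \<Longrightarrow> perm_poly \<sigma> (prod f A) = (\<Prod>i \<in> A. perm_poly \<sigma> (f i))"
  using perm_poly_of_int[of \<sigma> 1]
  by (induction A rule: infinite_finite_induct) (simp_all add: perm_poly_mult)

lemma perm_poly_power: "bij \<sigma> \<Longrightarrow> perm_poly \<sigma> (p ^ r) = perm_poly \<sigma> p ^ r"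
  using perm_poly_of_int[of \<sigma> 1] by (induction r) (simp_all add: perm_poly_mult)

lemma sgn_char_compose:
  "\<sigma> permutes {1..n} \<Longrightarrow> \<tau> permutes {1..n} \<Longrightarrow> sgn_char c (\<sigma> \<circ> \<tau>) = sgn_char c \<sigma> * sgn_char c \<tau>"
  by (auto simp: sgn_char_def intro: sign_compose permutes_imp_permutation)

lemma sgn_char_square: "sgn_char c \<sigma> * sgn_char c \<sigma> = 1"
  by (simp add: sgn_char_def)

section \<open>Alternants based at the extra point\<close>

text \<open>
  The Leibniz term, without its sign, of the determinant with entries \<open>(x\<^sub>i - x)\<^sup>\<alpha> (y\<^sub>i - y)\<^sup>\<beta>\<close>, one column
  for each exponent pair. Taking the extra point as origin places the determinant in \<open>I\<close> whenever no exponent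
  pair is \<open>(0, 0)\<close>, and leaves the trailing term unchanged because replacing an \<open>x\<^sub>i\<close> by \<open>x\<close>, or a \<open>y\<^sub>i\<close> by \<open>y\<close>,
  makes an exponent vector larger.
\<close>

definition alternant_term :: "nat \<Rightarrow> (nat \<Rightarrow> nat) \<Rightarrow> (nat \<Rightarrow> nat) \<Rightarrow> (nat \<Rightarrow> nat) \<Rightarrow> cpoly" where
  "alternant_term n \<alpha> \<beta> \<sigma> =
     (\<Prod>j \<in> {1..n}. (pvar (Xi (\<sigma> j)) - pvar X) ^ \<alpha> j * (pvar (Yi (\<sigma> j)) - pvar Y) ^ \<beta> j)"

text \<open>
  For odd \<open>c\<close> this is the determinant; for even \<open>c\<close> the sum is symmetric.
\<close>

definition alternant :: "nat \<Rightarrow> nat \<Rightarrow> (nat \<Rightarrow> nat) \<Rightarrow> (nat \<Rightarrow> nat) \<Rightarrow> cpoly" where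
  "alternant n c \<alpha> \<beta> =
     (\<Sum>\<sigma> | \<sigma> permutes {1..n}. of_int (sgn_char c \<sigma>) * alternant_term n \<alpha> \<beta> \<sigma>)"

lemma carrier_of_int: "of_int c \<in> carrier (poly_ring n)"
  using carrier_const[of "of_int c" n] by simp

lemma carrier_alternant_term:
  "\<sigma> permutes {1..n} \<Longrightarrow> alternant_term n \<alpha> \<beta> \<sigma> \<in> carrier (poly_ring n)"
  unfolding alternant_term_def
  by (intro carrier_prod carrier_mult carrier_power carrier_diff carrier_pvar)
    (auto simp: vars_def dest: permutes_in_image)

lemma carrier_alternant: "alternant n c \<alpha> \<beta> \<in> carrier (poly_ring n)"
  unfolding alternant_def by (auto intro!: carrier_sum carrier_mult carrier_of_int carrier_alternant_term)

lemma perm_poly_alternant_term: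
  assumes "\<tau> permutes {1..n}"
  shows "perm_poly \<tau> (alternant_term n \<alpha> \<beta> \<sigma>) = alternant_term n \<alpha> \<beta> (\<tau> \<circ> \<sigma>)"
  using permutes_bij[OF assms]
  by (simp add: alternant_term_def perm_poly_prod perm_poly_mult perm_poly_power perm_poly_diff
      perm_poly_pvar[OF assms])

lemma perm_poly_alternant:
  assumes \<tau>: "\<tau> permutes {1..n}"
  shows "perm_poly \<tau> (alternant n c \<alpha> \<beta>) = of_int (sgn_char c \<tau>) * alternant n c \<alpha> \<beta>"
proof -
  have bij: "bij \<tau>" by (rule permutes_bij[OF \<tau>])
  let ?T = "alternant_term n \<alpha> \<beta>"
  have "perm_poly \<tau> (alternant n c \<alpha> \<beta>) =
      (\<Sum>\<sigma> | \<sigma> permutes {1..n}. of_int (sgn_char c \<sigma>) * ?T (\<tau> \<circ> \<sigma>))"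
    by (simp add: alternant_def perm_poly_sum bij perm_poly_mult perm_poly_of_int
        perm_poly_alternant_term[OF \<tau>])
  also have "\<dots> = (\<Sum>\<sigma> | \<sigma> permutes {1..n}.
      of_int (sgn_char c \<tau>) * (of_int (sgn_char c (\<tau> \<circ> \<sigma>)) * ?T (\<tau> \<circ> \<sigma>)))"
  proof (intro sum.cong refl)
    fix \<sigma> assume "\<sigma> \<in> {\<sigma>. \<sigma> permutes {1..n}}"
    then have "sgn_char c \<sigma> = sgn_char c \<tau> * sgn_char c (\<tau> \<circ> \<sigma>)"
      using \<tau> by (simp add: sgn_char_compose sgn_char_square flip: mult.assoc)
    then show "of_int (sgn_char c \<sigma>) * ?T (\<tau> \<circ> \<sigma>) =
        of_int (sgn_char c \<tau>) * (of_int (sgn_char c (\<tau> \<circ> \<sigma>)) * ?T (\<tau> \<circ> \<sigma>))"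
      by (metis mult.assoc of_int_mult)
  qed
  also have "\<dots> = of_int (sgn_char c \<tau>) * alternant n c \<alpha> \<beta>"
    unfolding alternant_def
    by (subst setum_permutations_compose_left[OF \<tau>]) (simp add: sum_distrib_left)
  finally show ?thesis .
qed

text \<open>
  Swapping \<open>i\<close> and \<open>j\<close> is the identity modulo the ideal of the diagonal. The polynomials for which this holds are
  closed under differences and products, so it suffices to look at the variables.
\<close>

lemma diff_swap_in_diagonal_ideal:
  assumes K: "K = Idl\<^bsub>poly_ring n\<^esub> {pvar (Xi i) - pvar (Xi j), pvar (Yi i) - pvar (Yi j)}"
    and ij: "i \<in> {1..n}" "j \<in> {1..n}" and \<sigma>: "\<sigma> permutes {1..n}"
  shows "alternant_term n \<alpha> \<beta> \<sigma> - perm_poly (transpose i j) (alternant_term n \<alpha> \<beta> \<sigma>) \<in> K"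
proof -
  let ?s = "perm_poly (transpose i j)"
  have s: "transpose i j permutes {1..n}" using ij by (rule permutes_swap_id)
  have bij: "bij (transpose i j)" by simp
  let ?G = "{pvar (Xi i) - pvar (Xi j), pvar (Yi i) - pvar (Yi j)}"
  have G: "?G \<subseteq> carrier (poly_ring n)"
    using ij by (auto simp: vars_def intro!: carrier_diff carrier_pvar)
  have ideal: "ideal K (poly_ring n)" unfolding K by (rule ideal_Idl[OF G])
  note closed = ideal_poly_ring_closed[OF ideal]
  have uminus: "- p \<in> K" if "p \<in> K" for p
    using closed(4)[OF that, of "- 1"] by (simp add: carrier_uminus carrier_1)
  have GK: "?G \<subseteq> K" unfolding K by (rule ring.genideal_self[OF poly_ring_ring G])
  define Q where "Q = {p. p \<in> carrier (poly_ring n) \<and> ?s p \<in> carrier (poly_ring n) \<and> p - ?s p \<in> K}"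
  have mult: "p * q \<in> Q" if "p \<in> Q" "q \<in> Q" for p q
  proof -
    have "p * q - ?s (p * q) = p * (q - ?s q) + ?s q * (p - ?s p)"
      by (simp add: perm_poly_mult[OF bij] algebra_simps)
    then show ?thesis using that
      by (auto simp: Q_def perm_poly_mult[OF bij] intro: closed carrier_mult)
  qed
  have diff: "p - q \<in> Q" if "p \<in> Q" "q \<in> Q" for p q
  proof -
    have "p - q - ?s (p - q) = (p - ?s p) + - (q - ?s q)"
      by (simp add: perm_poly_diff[OF bij])
    moreover have "(p - ?s p) + - (q - ?s q) \<in> K"
      using that by (intro closed(3) uminus) (auto simp: Q_def)
    ultimately have "p - q - ?s (p - q) \<in> K" by (simp only:)
    then show ?thesis using that
      by (simp add: Q_def perm_poly_diff[OF bij] carrier_diff)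
  qed
  have one: "1 \<in> Q"
    using perm_poly_of_int[OF bij, of 1] closed(2) by (simp add: Q_def carrier_1)
  have power: "p ^ r \<in> Q" if "p \<in> Q" for p r
    using that by (induction r) (auto intro: one mult)
  have prod: "prod f A \<in> Q" if "\<And>i. i \<in> A \<Longrightarrow> f i \<in> Q" for f :: "nat \<Rightarrow> cpoly" and A
    using that by (induction A rule: infinite_finite_induct) (auto intro: one mult)
  have var: "pvar z \<in> Q" if z: "z \<in> vars n" for z
  proof -
    have "perm_var (transpose i j) z \<in> vars n"
      using z ij by (cases z) (auto simp: vars_def transpose_def)
    moreover have "pvar z - ?s (pvar z) \<in> K"
      using GK uminus[of "pvar (Xi i) - pvar (Xi j)"] uminus[of "pvar (Yi i) - pvar (Yi j)"] closed(2)
      unfolding perm_poly_pvar[OF s] by (cases z) (auto simp: transpose_def)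
    ultimately show ?thesis
      using z by (simp add: Q_def perm_poly_pvar[OF s] carrier_pvar)
  qed
  have "alternant_term n \<alpha> \<beta> \<sigma> \<in> Q"
    unfolding alternant_term_def using permutes_in_image[OF \<sigma>]
    by (intro prod mult power diff var) (auto simp: vars_def)
  then show ?thesis by (simp add: Q_def)
qed

text \<open>
  For odd \<open>c\<close> the swap of \<open>i\<close> and \<open>j\<close> negates the alternant \<open>D\<close>, so that \<open>D\<close> minus its swap, which lies in
  the ideal of the diagonal, is \<open>2 D\<close>.
\<close>

lemma alternant_in_J:
  assumes "odd c"
  shows "alternant n c \<alpha> \<beta> \<in> ideal_J n"
  unfolding ideal_J_def
proof (intro IntI INT_I carrier_alternant, clarify)
  fix i j assume ij: "1 \<le> i" "i < j" "j \<le> n"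
  let ?K = "Idl\<^bsub>poly_ring n\<^esub> {pvar (Xi i) - pvar (Xi j), pvar (Yi i) - pvar (Yi j)}"
  let ?s = "perm_poly (transpose i j)" and ?D = "alternant n c \<alpha> \<beta>"
  have s: "transpose i j permutes {1..n}" using ij by (intro permutes_swap_id) auto
  have bij: "bij (transpose i j)" by simp
  have ideal: "ideal ?K (poly_ring n)"
    using ij by (intro ideal_Idl) (auto simp: vars_def intro!: carrier_diff carrier_pvar)
  note closed = ideal_poly_ring_closed[OF ideal]
  have sum: "sum f A \<in> ?K" if "\<And>i. i \<in> A \<Longrightarrow> f i \<in> ?K" for f :: "(nat \<Rightarrow> nat) \<Rightarrow> cpoly" and A
    using that by (induction A rule: infinite_finite_induct) (auto intro: closed)
  have "?D - ?s ?D = (\<Sum>\<sigma> | \<sigma> permutes {1..n}. of_int (sgn_char c \<sigma>) *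
      (alternant_term n \<alpha> \<beta> \<sigma> - ?s (alternant_term n \<alpha> \<beta> \<sigma>)))"
    by (simp add: alternant_def perm_poly_sum perm_poly_mult perm_poly_of_int right_diff_distrib sum_subtractf)
  also have "\<dots> \<in> ?K"
    using ij by (intro sum closed(4) diff_swap_in_diagonal_ideal carrier_of_int) auto
  finally have "?D - ?s ?D \<in> ?K" .
  moreover have "?s ?D = - ?D"
    using ij assms by (simp add: perm_poly_alternant[OF s] sgn_char_def sign_swap_id)
  ultimately have "?D + ?D \<in> ?K" by simp
  then have "single 0 (1 / 2) * (?D + ?D) \<in> ?K"
    by (intro closed(4) carrier_const)
  also have "single 0 (1 / 2) * (?D + ?D) = (single 0 (1 / 2) + single 0 (1 / 2)) * ?D"
    by (simp add: algebra_simps)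
  also have "\<dots> = ?D"
    by (simp flip: single_add)
  finally show "?D \<in> ?K" .
qed

text \<open>
  Every Leibniz term has, for each point \<open>l\<close>, a factor involving that point only, and that factor lies in the ideal
  \<open>(x\<^sub>l - x, y\<^sub>l - y)\<close> unless its exponent pair is \<open>(0, 0)\<close>.
\<close>

lemma alternant_in_I:
  assumes "\<And>j. j \<in> {1..n} \<Longrightarrow> \<alpha> j \<noteq> 0 \<or> \<beta> j \<noteq> 0"
  shows "alternant n c \<alpha> \<beta> \<in> ideal_I n"
  unfolding ideal_I_def
proof (intro IntI INT_I carrier_alternant)
  fix l assume l: "l \<in> {1..n}"
  let ?G = "{pvar (Xi l) - pvar X, pvar (Yi l) - pvar Y}"
  let ?K = "Idl\<^bsub>poly_ring n\<^esub> ?G"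
  have G: "?G \<subseteq> carrier (poly_ring n)"
    using l by (auto simp: vars_def intro!: carrier_diff carrier_pvar)
  note closed = ideal_poly_ring_closed[OF ideal_Idl[OF G]]
  have GK: "?G \<subseteq> ?K" by (rule ring.genideal_self[OF poly_ring_ring G])
  have sum: "sum f A \<in> ?K" if "\<And>i. i \<in> A \<Longrightarrow> f i \<in> ?K" for f :: "(nat \<Rightarrow> nat) \<Rightarrow> cpoly" and A
    using that by (induction A rule: infinite_finite_induct) (auto intro: closed)
  have power: "p ^ r \<in> ?K" if "p \<in> ?K" "r \<noteq> 0" for p r
    using that closed(1) by (cases r) (auto simp: mult.commute[of p] intro!: closed(4) carrier_power)
  have "alternant_term n \<alpha> \<beta> \<sigma> \<in> ?K" if \<sigma>: "\<sigma> permutes {1..n}" for \<sigma>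
  proof -
    define j where "j = inv_into UNIV \<sigma> l"
    have j: "j \<in> {1..n}" "\<sigma> j = l"
      using l \<sigma> permutes_in_image[OF permutes_inv[OF \<sigma>]] permutes_inverses(1)[OF \<sigma>]
      by (auto simp: j_def)
    define F where "F j = (pvar (Xi (\<sigma> j)) - pvar X) ^ \<alpha> j * (pvar (Yi (\<sigma> j)) - pvar Y) ^ \<beta> j" for j
    have carF: "F j \<in> carrier (poly_ring n)" if "j \<in> {1..n}" for j
      unfolding F_def using that permutes_in_image[OF \<sigma>, of j]
      by (intro carrier_mult carrier_power carrier_diff carrier_pvar) (auto simp: vars_def)
    have "F j \<in> ?K"
    proof (cases "\<alpha> j = 0")
      case True
      then show ?thesis using assms[OF j(1)] GK by (auto simp: F_def j(2) intro: power)
    next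
      case False
      then show ?thesis using GK G unfolding F_def j(2)
        by (subst mult.commute) (auto intro!: closed(4) power carrier_power)
    qed
    then have "prod F ({1..n} - {j}) * F j \<in> ?K"
      by (intro closed(4) carrier_prod carF) auto
    then show ?thesis
      using prod.remove[of "{1..n}" j F] j(1) by (simp add: alternant_term_def F_def mult.commute)
  qed
  then show "alternant n c \<alpha> \<beta> \<in> ?K"
    unfolding alternant_def by (intro sum closed(4) carrier_of_int) auto
qed

section \<open>Trailing terms of alternants\<close>

definition expo_of :: "nat \<Rightarrow> (nat \<Rightarrow> nat) \<Rightarrow> (nat \<Rightarrow> nat) \<Rightarrow> expo" where
  "expo_of n \<alpha> \<beta> = (\<Sum>i \<in> {1..n}. single (Xi i) (\<alpha> i) + single (Yi i) (\<beta> i))"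

lemma lookup_expo_of [simp]:
  "lookup (expo_of n \<alpha> \<beta>) X = 0" "lookup (expo_of n \<alpha> \<beta>) Y = 0"
  "lookup (expo_of n \<alpha> \<beta>) (Xi l) = (if l \<in> {1..n} then \<alpha> l else 0)"
  "lookup (expo_of n \<alpha> \<beta>) (Yi l) = (if l \<in> {1..n} then \<beta> l else 0)"
  by (simp_all add: expo_of_def lookup_sum lookup_add lookup_single when_def)

lemma expo_of_eq_iff:
  "expo_of n \<alpha> \<beta> = expo_of n \<alpha>' \<beta>' \<longleftrightarrow> (\<forall>i \<in> {1..n}. \<alpha> i = \<alpha>' i \<and> \<beta> i = \<beta>' i)"
proof
  assume eq: "expo_of n \<alpha> \<beta> = expo_of n \<alpha>' \<beta>'"
  show "\<forall>i \<in> {1..n}. \<alpha> i = \<alpha>' i \<and> \<beta> i = \<beta>' i"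
  proof
    fix i assume "i \<in> {1..n}"
    then show "\<alpha> i = \<alpha>' i \<and> \<beta> i = \<beta>' i"
      using arg_cong[OF eq, of "\<lambda>e. lookup e (Xi i)"] arg_cong[OF eq, of "\<lambda>e. lookup e (Yi i)"] by simp
  qed
qed (simp add: expo_of_def)

lemma trails_alternant_term:
  assumes \<sigma>: "\<sigma> permutes {1..n}"
  shows "trails n (alternant_term n \<alpha> \<beta> \<sigma>) (expo_of n (\<alpha> \<circ> inv_into UNIV \<sigma>) (\<beta> \<circ> inv_into UNIV \<sigma>)) 1"
proof -
  have "trails n (alternant_term n \<alpha> \<beta> \<sigma>)
      (\<Sum>j \<in> {1..n}. single (Xi (\<sigma> j)) (\<alpha> j) + single (Yi (\<sigma> j)) (\<beta> j)) (\<Prod>j \<in> {1..n}. 1 * 1)"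
    unfolding alternant_term_def
    by (intro trails_prod trails_mult trails_power trails_diff_base)
  moreover have "expo_of n (\<alpha> \<circ> inv_into UNIV \<sigma>) (\<beta> \<circ> inv_into UNIV \<sigma>) =
      (\<Sum>j \<in> {1..n}. single (Xi (\<sigma> j)) (\<alpha> j) + single (Yi (\<sigma> j)) (\<beta> j))"
    unfolding expo_of_def by (subst sum.permute[OF \<sigma>]) (simp add: o_def permutes_inverses[OF \<sigma>])
  ultimately show ?thesis by simp
qed

lemma permutes_maps_no_new_point:
  assumes "\<tau> permutes A" "finite S" "\<And>i. i \<in> S \<Longrightarrow> \<tau> i \<in> S" "l \<notin> S"
  shows "\<tau> l \<notin> S"
proof
  assume "\<tau> l \<in> S"
  have "inj_on \<tau> S" using permutes_inj[OF assms(1)] by (rule inj_on_subset) simp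
  then have "\<tau> ` S = S" using assms(2,3) by (intro card_subset_eq) (auto simp: card_image)
  then obtain i where "i \<in> S" "\<tau> i = \<tau> l" using \<open>\<tau> l \<in> S\<close> by (metis imageE)
  then show False using permutes_inj[OF assms(1)] assms(4) by (auto dest: injD)
qed

text \<open>
  Among the rearrangements of a sorted sequence of pairs the sorted one is lexicographically smallest, also when all
  first components are compared before the second ones. In both comparisons, if \<open>l\<close> is the first index at which
  the rearrangement differs, the entries below the \<open>l\<close>-th one occupy positions before \<open>l\<close> and are permuted among
  themselves, so none of them is left for position \<open>l\<close>. The entries are the first components at first; once these are known
  to be unchanged, they are the pairs.
\<close>

lemma sorted_pairs_minimal:
  assumes \<tau>: "\<tau> permutes {1..n}"
    and sorted: "\<And>i j. 1 \<le> i \<Longrightarrow> i < j \<Longrightarrow> j \<le> n \<Longrightarrow> \<alpha> i < \<alpha> j \<or> \<alpha> i = \<alpha> j \<and> \<beta> i \<le> \<beta> j"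
  shows "expo_of n (\<alpha> \<circ> \<tau>) (\<beta> \<circ> \<tau>) = expo_of n \<alpha> \<beta> \<or>
    prec n (expo_of n \<alpha> \<beta>) (expo_of n (\<alpha> \<circ> \<tau>) (\<beta> \<circ> \<tau>))"
proof (rule disjCI)
  let ?e = "expo_of n \<alpha> \<beta>" and ?f = "expo_of n (\<alpha> \<circ> \<tau>) (\<beta> \<circ> \<tau>)"
  have in_range: "\<tau> i \<in> {1..n} \<longleftrightarrow> i \<in> {1..n}" for i by (rule permutes_in_image[OF \<tau>])
  have sorted': "i < l" if "i \<in> {1..n}" "l \<in> {1..n}" "\<alpha> i < \<alpha> l \<or> \<alpha> i = \<alpha> l \<and> \<beta> i < \<beta> l" for i l
    using sorted[of l i] that by (cases i l rule: linorder_cases) auto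
  assume "\<not> prec n ?e ?f"
  have \<alpha>: "\<alpha> (\<tau> l) = \<alpha> l" if "l \<in> {1..n}" for l
    using that
  proof (induction l rule: less_induct)
    case (less l)
    let ?S = "{i \<in> {1..n}. \<alpha> i < \<alpha> l}"
    have "\<tau> l \<notin> ?S"
      using less sorted' in_range by (intro permutes_maps_no_new_point[OF \<tau>]) auto
    then have "\<alpha> l \<le> \<alpha> (\<tau> l)" using in_range[of l] less.prems by auto
    moreover have "\<not> \<alpha> l < \<alpha> (\<tau> l)"
    proof
      assume "\<alpha> l < \<alpha> (\<tau> l)"
      then have "prec n ?e ?f"
        using less by (intro prec_at(1)[OF vlist_split(1)[OF less.prems]]) auto
      then show False using \<open>\<not> prec n ?e ?f\<close> by simp
    qed
    ultimately show ?case by simp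
  qed
  have "\<beta> (\<tau> l) = \<beta> l" if "l \<in> {1..n}" for l
    using that
  proof (induction l rule: less_induct)
    case (less l)
    let ?S = "{i \<in> {1..n}. \<alpha> i < \<alpha> l \<or> \<alpha> i = \<alpha> l \<and> \<beta> i < \<beta> l}"
    have "\<tau> i \<in> ?S" if "i \<in> ?S" for i
      using that less.IH[of i] sorted'[of i l] less.prems \<alpha>[of i] in_range[of i] by auto
    then have "\<tau> l \<notin> ?S"
      by (intro permutes_maps_no_new_point[OF \<tau>]) auto
    then have "\<beta> l \<le> \<beta> (\<tau> l)" using in_range[of l] less.prems \<alpha>[of l] by auto
    moreover have "\<not> \<beta> l < \<beta> (\<tau> l)"
    proof
      assume "\<beta> l < \<beta> (\<tau> l)"
      then have "prec n ?e ?f"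
        using less \<alpha> by (intro prec_at(1)[OF vlist_split(2)[OF less.prems]]) auto
      then show False using \<open>\<not> prec n ?e ?f\<close> by simp
    qed
    ultimately show ?case by simp
  qed
  with \<alpha> show "?f = ?e" by (simp add: expo_of_eq_iff)
qed

text \<open>
  Only the permutations that preserve the sequence of pairs reach the smallest exponent.
\<close>

lemma trails_alternant:
  assumes sorted: "\<And>i j. 1 \<le> i \<Longrightarrow> i < j \<Longrightarrow> j \<le> n \<Longrightarrow> \<alpha> i < \<alpha> j \<or> \<alpha> i = \<alpha> j \<and> \<beta> i \<le> \<beta> j"
  shows "trails n (alternant n c \<alpha> \<beta>) (expo_of n \<alpha> \<beta>)
    (\<Sum>\<sigma> | \<sigma> permutes {1..n}.
      if expo_of n (\<alpha> \<circ> inv_into UNIV \<sigma>) (\<beta> \<circ> inv_into UNIV \<sigma>) = expo_of n \<alpha> \<beta>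
      then of_int (sgn_char c \<sigma>) else 0)"
  unfolding alternant_def
proof (rule trails_sum)
  fix \<sigma> assume "\<sigma> \<in> {\<sigma>. \<sigma> permutes {1..n}}"
  then have \<sigma>: "\<sigma> permutes {1..n}" by simp
  let ?f = "expo_of n (\<alpha> \<circ> inv_into UNIV \<sigma>) (\<beta> \<circ> inv_into UNIV \<sigma>)"
  have "trails n (of_int (sgn_char c \<sigma>)) 0 (of_int (sgn_char c \<sigma>))"
    using trails_single[of n 0 "of_int (sgn_char c \<sigma>)"] by simp
  from trails_mult[OF this trails_alternant_term[OF \<sigma>]]
  have "trails n (of_int (sgn_char c \<sigma>) * alternant_term n \<alpha> \<beta> \<sigma>) ?f (of_int (sgn_char c \<sigma>))"
    by simp
  then show "trails n (of_int (sgn_char c \<sigma>) * alternant_term n \<alpha> \<beta> \<sigma>) (expo_of n \<alpha> \<beta>)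
      (if ?f = expo_of n \<alpha> \<beta> then of_int (sgn_char c \<sigma>) else 0)"
    using sorted_pairs_minimal[OF permutes_inv[OF \<sigma>], of \<alpha> \<beta>] sorted trails_prec
    by (cases "?f = expo_of n \<alpha> \<beta>") auto
qed

lemma trails_alternant_strict:
  assumes sorted: "\<And>i j. 1 \<le> i \<Longrightarrow> i < j \<Longrightarrow> j \<le> n \<Longrightarrow> \<alpha> i < \<alpha> j \<or> \<alpha> i = \<alpha> j \<and> \<beta> i < \<beta> j"
  shows "trails n (alternant n c \<alpha> \<beta>) (expo_of n \<alpha> \<beta>) 1"
proof -
  have id: "\<sigma> = id" if \<sigma>: "\<sigma> permutes {1..n}"
    and eq: "expo_of n (\<alpha> \<circ> inv_into UNIV \<sigma>) (\<beta> \<circ> inv_into UNIV \<sigma>) = expo_of n \<alpha> \<beta>" for \<sigma>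
  proof -
    define \<tau> where "\<tau> = inv_into UNIV \<sigma>"
    have \<tau>: "\<tau> permutes {1..n}" unfolding \<tau>_def by (rule permutes_inv[OF \<sigma>])
    have "\<tau> i = i" for i
    proof (cases "i \<in> {1..n}")
      case True
      then have "\<tau> i \<in> {1..n}" "\<alpha> (\<tau> i) = \<alpha> i" "\<beta> (\<tau> i) = \<beta> i"
        using eq permutes_in_image[OF \<tau>, of i] by (auto simp: expo_of_eq_iff \<tau>_def)
      then show ?thesis
        using sorted[of i "\<tau> i"] sorted[of "\<tau> i" i] True by (cases i "\<tau> i" rule: linorder_cases) auto
    next
      case False
      then show ?thesis using permutes_not_in[OF \<tau>] by blast
    qed
    then show ?thesis using permutes_inverses(1)[OF \<sigma>] by (auto simp: \<tau>_def)
  qed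
  have "(\<Sum>\<sigma> | \<sigma> permutes {1..n}.
      if expo_of n (\<alpha> \<circ> inv_into UNIV \<sigma>) (\<beta> \<circ> inv_into UNIV \<sigma>) = expo_of n \<alpha> \<beta>
      then of_int (sgn_char c \<sigma>) else 0) =
    (\<Sum>\<sigma> | \<sigma> permutes {1..n}. if \<sigma> = id then 1 else (0 :: complex))"
    using id by (intro sum.cong) (auto simp: sgn_char_def)
  also have "\<dots> = 1" by (simp add: finite_permutations permutes_id)
  finally show ?thesis
    using trails_alternant[of n \<alpha> \<beta> c] sorted by fastforce
qed

lemma trails_symmetrised:
  assumes sorted: "\<And>i j. 1 \<le> i \<Longrightarrow> i < j \<Longrightarrow> j \<le> n \<Longrightarrow> \<alpha> i < \<alpha> j \<or> \<alpha> i = \<alpha> j \<and> \<beta> i \<le> \<beta> j"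
  obtains r where "r \<noteq> 0" "trails n (alternant n 0 \<alpha> \<beta>) (expo_of n \<alpha> \<beta>) r"
proof
  let ?Q = "\<lambda>\<sigma>. expo_of n (\<alpha> \<circ> inv_into UNIV \<sigma>) (\<beta> \<circ> inv_into UNIV \<sigma>) = expo_of n \<alpha> \<beta>"
  show "trails n (alternant n 0 \<alpha> \<beta>) (expo_of n \<alpha> \<beta>) (of_nat (card {\<sigma>. \<sigma> permutes {1..n} \<and> ?Q \<sigma>}))"
    using trails_alternant[of n \<alpha> \<beta> 0, OF sorted]
    by (simp add: sgn_char_def finite_permutations sum.If_cases Int_def conj_commute)
  have "id \<in> {\<sigma>. \<sigma> permutes {1..n} \<and> ?Q \<sigma>}" by (simp add: permutes_id)
  moreover have "finite {\<sigma>. \<sigma> permutes {1..n} \<and> ?Q \<sigma>}"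
    by (rule finite_subset[OF _ finite_permutations[of "{1..n}"]]) auto
  ultimately have "card {\<sigma>. \<sigma> permutes {1..n} \<and> ?Q \<sigma>} \<noteq> 0"
    unfolding card_eq_0_iff by blast
  then show "of_nat (card {\<sigma>. \<sigma> permutes {1..n} \<and> ?Q \<sigma>}) \<noteq> (0 :: complex)"
    by simp
qed

section \<open>Splitting exponents by rounding\<close>

text \<open>
  Hermite's identity. Passing from \<open>a\<close> to \<open>a + 1\<close> trades the summand \<open>a div d\<close> for \<open>(a + d) div d\<close>, which is one larger.
\<close>

lemma sum_shifted_div:
  assumes "d > 0"
  shows "(\<Sum>t < d. (a + t) div d) = (a :: nat)"
proof (induction a)
  case 0
  then show ?case by simp
next
  case (Suc a)
  have "(\<Sum>t < d. (Suc a + t) div d) + a div d = (\<Sum>t < Suc d. (a + t) div d)"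
    by (subst sum.lessThan_Suc_shift) simp
  also have "\<dots> = a + (a + d) div d" by (simp add: Suc.IH)
  also have "\<dots> = Suc a + a div d" using assms by simp
  finally show ?case by simp
qed

text \<open>
  Shifting \<open>a\<close> by \<open>c \<le> d\<close> raises each quotient by at most one, and by \<open>c\<close> in total; the other \<open>d - c\<close> quotients
  stay equal. For \<open>c > d\<close> every quotient changes.
\<close>

lemma count_equal_shifted_div:
  assumes "d > 0"
  shows "(\<Sum>t < d. of_bool ((a + t) div d = (a + c + t) div d)) = d - (c :: nat)"
proof (cases "c \<le> d")
  case True
  have step: "(a + c + t) div d + of_bool ((a + t) div d = (a + c + t) div d) = (a + t) div d + 1" for t
  proof -
    have "(a + c + t) div d \<le> (a + t + d) div d" using True by (intro div_le_mono) simp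
    moreover have "(a + t) div d \<le> (a + c + t) div d" by (intro div_le_mono) simp
    ultimately show ?thesis using assms by auto
  qed
  have "(\<Sum>t < d. (a + c + t) div d + of_bool ((a + t) div d = (a + c + t) div d)) = a + d"
    unfolding step sum.distrib sum_shifted_div[OF assms] by simp
  then show ?thesis by (simp add: sum.distrib sum_shifted_div[OF assms])
next
  case False
  have "(a + t) div d < (a + c + t) div d" for t
  proof -
    have "(a + t + d) div d \<le> (a + c + t) div d" using False by (intro div_le_mono) simp
    then show ?thesis using assms by simp
  qed
  then have "(a + t) div d \<noteq> (a + c + t) div d" for t using less_imp_neq by blast
  then show ?thesis using False by simp
qed

section \<open>Construction of sections\<close>

lemma prod_in_ideal_pow:
  assumes "finite S" "\<And>t. t \<in> S \<Longrightarrow> f t \<in> T"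
  shows "prod f S \<in> T [^]\<^bsub>ideals_set (poly_ring n)\<^esub> card S"
  using assms
proof (induction S rule: finite_induct)
  case empty
  then show ?case by (simp only: card.empty ideal_pow_simps prod.empty carrier_1)
next
  case (insert x S)
  have "prod f S \<otimes>\<^bsub>poly_ring n\<^esub> f x \<in> T [^]\<^bsub>ideals_set (poly_ring n)\<^esub> Suc (card S)"
    unfolding ideal_pow_simps by (intro ideal_prod.prod insert) (use insert in auto)
  then show ?case using insert by (simp add: poly_ring_simps mult.commute del: nat_pow_Suc)
qed

lemma sgn_char_power: "sgn_char 1 \<sigma> ^ d = sgn_char d \<sigma>"
  by (auto simp: sgn_char_def sign_def)

lemma perm_poly_base_monomial:
  assumes "\<sigma> permutes {1..n}"
  shows "perm_poly \<sigma> (pvar X ^ a * pvar Y ^ b) = pvar X ^ a * pvar Y ^ b"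
  using permutes_bij[OF assms] by (simp add: perm_poly_mult perm_poly_power perm_poly_pvar[OF assms])

lemma trails_base_monomial: "trails n (pvar X ^ a * pvar Y ^ b) (single X a + single Y b) 1"
  using trails_mult[OF trails_power[OF trails_pvar] trails_power[OF trails_pvar]] by simp

lemma carrier_base_monomial: "pvar X ^ a * pvar Y ^ b \<in> carrier (poly_ring n)"
  by (intro carrier_mult carrier_power carrier_pvar) (auto simp: vars_def)

text \<open>
  Without any vanishing condition a symmetrised monomial is enough.
\<close>

lemma section_exists_0:
  assumes sorted: "\<And>i j. 1 \<le> i \<Longrightarrow> i < j \<Longrightarrow> j \<le> n \<Longrightarrow> \<alpha> i < \<alpha> j \<or> \<alpha> i = \<alpha> j \<and> \<beta> i \<le> \<beta> j"
  shows "\<exists>g \<in> H0 n 0 0. is_trailing n g (expo_vec n (single X a + single Y b + expo_of n \<alpha> \<beta>))"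
proof -
  obtain r where r: "r \<noteq> 0" "trails n (alternant n 0 \<alpha> \<beta>) (expo_of n \<alpha> \<beta>) r"
    using trails_symmetrised[of n \<alpha> \<beta>] sorted by blast
  let ?g = "pvar X ^ a * pvar Y ^ b * alternant n 0 \<alpha> \<beta>"
  have tr: "is_trailing n ?g (expo_vec n (single X a + single Y b + expo_of n \<alpha> \<beta>))"
    using r by (intro is_trailingI[OF trails_mult[OF trails_base_monomial r(2)]]) simp
  have "?g \<in> carrier (poly_ring n)"
    by (intro carrier_mult carrier_base_monomial carrier_alternant)
  moreover have "perm_poly \<sigma> ?g = ?g" if \<sigma>: "\<sigma> permutes {1..n}" for \<sigma>
    by (simp only: perm_poly_mult[OF permutes_bij[OF \<sigma>], of _ "alternant n 0 \<alpha> \<beta>"]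
        perm_poly_base_monomial[OF \<sigma>] perm_poly_alternant[OF \<sigma>])
      (simp add: sgn_char_def)
  ultimately have "?g \<in> H0 n 0 0"
    unfolding H0_def add_0 ideal_pow_simps by (simp add: sgn_char_def)
  then show ?thesis using tr by blast
qed

text \<open>
  The section is a product of \<open>d = m + k\<close> alternants, the last \<open>k\<close> of which lie in \<open>I\<close>. As first exponents they
  have the rounded quotients \<open>(as j + t) div d\<close> for \<open>t < d\<close>, which add up to \<open>as j\<close>; for \<open>i < j\<close> those of \<open>i\<close>
  and \<open>j\<close> agree for exactly \<open>max (d - (as j - as i)) 0\<close> values of \<open>t\<close>. Each agreement forces the second
  exponent of \<open>j\<close> up by one, and so does each vanishing quotient with \<open>t \<ge> m\<close>, which would otherwise permit the pair \<open>(0, 0)\<close>. The forced amounts add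
  up to exactly the required lower bound for \<open>bs j\<close>.

  The excess of \<open>bs j\<close> over that bound goes entirely into the one alternant \<open>t\<close> at which the quotient is about to
  jump, \<open>(as j + 1 + t) div d \<noteq> (as j + t) div d\<close>: there every \<open>i > j\<close> with \<open>as i > as j\<close> already has a
  larger first exponent, and so the order is not disturbed.
\<close>

lemma section_exists_pos:
  fixes n m k a b :: nat and as bs :: "nat \<Rightarrow> nat"
  defines "d \<equiv> m + k"
  assumes d: "d > 0"
    and mono: "\<And>i j. 1 \<le> i \<Longrightarrow> i \<le> j \<Longrightarrow> j \<le> n \<Longrightarrow> as i \<le> as j"
    and tie: "\<And>j. 1 \<le> j \<Longrightarrow> j < n \<Longrightarrow> as j = as (Suc j) \<Longrightarrow> bs j + d \<le> bs (Suc j)"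
    and bound: "\<And>j. 1 \<le> j \<Longrightarrow> j \<le> n \<Longrightarrow> (k - as j) + (\<Sum>i \<in> {1..<j}. d - (as j - as i)) \<le> bs j"
  shows "\<exists>g \<in> H0 n m k. is_trailing n g (expo_vec n (single X a + single Y b + expo_of n as bs))"
proof -
  define slack where "slack j = bs j - ((k - as j) + (\<Sum>i \<in> {1..<j}. d - (as j - as i)))" for j
  define \<alpha> where "\<alpha> t j = (as j + t) div d" for t j
  define \<beta> where "\<beta> t j = of_bool (m \<le> t \<and> \<alpha> t j = 0) + (\<Sum>i \<in> {1..<j}. of_bool (\<alpha> t i = \<alpha> t j))
      + of_bool (\<alpha> t j \<noteq> (as j + 1 + t) div d) * slack j" for t j
  \<comment> \<open>Within a tie the bound grows by \<open>d\<close> per index, the same as the gap that \<open>tie\<close> demands.\<close>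
  have slack_mono: "slack i \<le> slack j" if "1 \<le> i" "i \<le> j" "j \<le> n" "as i = as j" for i j
    using that(2,1,3,4)
  proof (induction j rule: dec_induct)
    case (step j)
    have eq: "as i = as j" "as (Suc j) = as j"
      using step mono[of i j] mono[of j "Suc j"] by auto
    then have "slack i \<le> slack j" using step by simp
    also have "slack j \<le> slack (Suc j)"
      using tie[of j] step eq by (simp add: slack_def)
    finally show ?case .
  qed simp
  have strict: "\<alpha> t i < \<alpha> t j \<or> \<alpha> t i = \<alpha> t j \<and> \<beta> t i < \<beta> t j" if ij: "1 \<le> i" "i < j" "j \<le> n" for t i j
  proof -
    have "\<alpha> t i \<le> \<alpha> t j"
      unfolding \<alpha>_def using ij mono[of i j] by (intro div_le_mono) simp
    moreover have "\<beta> t i < \<beta> t j" if eq: "\<alpha> t i = \<alpha> t j"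
    proof -
      have "(\<Sum>l \<in> {1..<i}. of_bool (\<alpha> t l = \<alpha> t i)) + 1
          = (\<Sum>l \<in> insert i {1..<i}. of_bool (\<alpha> t l = \<alpha> t j) :: nat)"
        by (simp add: eq)
      also have "\<dots> \<le> (\<Sum>l \<in> {1..<j}. of_bool (\<alpha> t l = \<alpha> t j))"
        using ij by (intro sum_mono2) auto
      finally have "(\<Sum>l \<in> {1..<i}. of_bool (\<alpha> t l = \<alpha> t i))
          < (\<Sum>l \<in> {1..<j}. of_bool (\<alpha> t l = \<alpha> t j) :: nat)"
        by simp
      moreover have "of_bool (\<alpha> t i \<noteq> (as i + 1 + t) div d) * slack i
          \<le> of_bool (\<alpha> t j \<noteq> (as j + 1 + t) div d) * slack j"
      proof (cases "\<alpha> t i = (as i + 1 + t) div d")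
        case False
        moreover have "\<alpha> t i \<le> (as i + 1 + t) div d" unfolding \<alpha>_def by (intro div_le_mono) simp
        ultimately have "\<alpha> t j < (as i + 1 + t) div d" unfolding eq by (rule le_neq_trans[rotated])
        then have less: "(as j + t) div d < (as i + 1 + t) div d" by (simp only: \<alpha>_def)
        have "\<not> as i + 1 \<le> as j"
        proof
          assume "as i + 1 \<le> as j"
          then have "(as i + 1 + t) div d \<le> (as j + t) div d" by (intro div_le_mono) simp
          then show False using less by simp
        qed
        then have "as i = as j" using mono[of i j] ij by simp
        then show ?thesis using slack_mono[of i j] ij eq by simp
      qed simp
      ultimately show ?thesis unfolding \<beta>_def using eq by simp
    qed
    ultimately show ?thesis by linarith
  qed
  have sum_\<alpha>: "(\<Sum>t < d. \<alpha> t j) = as j" for j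
    unfolding \<alpha>_def by (rule sum_shifted_div[OF d])
  have sum_\<beta>: "(\<Sum>t < d. \<beta> t j) = bs j" if j: "j \<in> {1..n}" for j
  proof -
    have "(\<Sum>t < d. of_bool (m \<le> t \<and> \<alpha> t j = 0)) = card {t \<in> {..<d}. m \<le> t \<and> \<alpha> t j = 0}"
      by (simp add: Int_def conj_commute)
    also have "{t \<in> {..<d}. m \<le> t \<and> \<alpha> t j = 0} = {m..<d - as j}"
      using d by (auto simp: \<alpha>_def div_eq_0_iff)
    finally have 1: "(\<Sum>t < d. of_bool (m \<le> t \<and> \<alpha> t j = 0)) = k - as j"
      by (simp add: d_def)
    have "(\<Sum>t < d. \<Sum>i \<in> {1..<j}. of_bool (\<alpha> t i = \<alpha> t j)) =
        (\<Sum>i \<in> {1..<j}. \<Sum>t < d. of_bool (\<alpha> t i = \<alpha> t j) :: nat)"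
      by (rule sum.swap)
    also have "\<dots> = (\<Sum>i \<in> {1..<j}. d - (as j - as i))"
    proof (intro sum.cong refl)
      fix i assume "i \<in> {1..<j}"
      then show "(\<Sum>t < d. of_bool (\<alpha> t i = \<alpha> t j)) = d - (as j - as i)"
        using count_equal_shifted_div[OF d, of "as i" "as j - as i"] mono[of i j] j
        by (simp add: \<alpha>_def)
    qed
    finally have 2: "(\<Sum>t < d. \<Sum>i \<in> {1..<j}. of_bool (\<alpha> t i = \<alpha> t j)) =
        (\<Sum>i \<in> {1..<j}. d - (as j - as i))" .
    have "(\<Sum>t < d. of_bool (\<alpha> t j \<noteq> (as j + 1 + t) div d)) +
        (\<Sum>t < d. of_bool (\<alpha> t j = (as j + 1 + t) div d)) = (\<Sum>t < d. 1 :: nat)"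
      unfolding sum.distrib[symmetric] by (intro sum.cong) auto
    then have 3: "(\<Sum>t < d. of_bool (\<alpha> t j \<noteq> (as j + 1 + t) div d)) = (1 :: nat)"
      using count_equal_shifted_div[OF d, of "as j" 1] d by (simp add: \<alpha>_def)
    have "(\<Sum>t < d. \<beta> t j) = (k - as j) + (\<Sum>i \<in> {1..<j}. d - (as j - as i)) + 1 * slack j"
      unfolding \<beta>_def sum.distrib sum_distrib_right[symmetric] 1 2 3 by simp
    then show ?thesis using bound[of j] j by (simp add: slack_def)
  qed
  define g where "g = pvar X ^ a * pvar Y ^ b * (\<Prod>t < d. alternant n 1 (\<alpha> t) (\<beta> t))"
  have "(\<Sum>t < d. expo_of n (\<alpha> t) (\<beta> t)) = expo_of n as bs"
  proof (rule poly_mapping_eqI)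
    show "lookup (\<Sum>t < d. expo_of n (\<alpha> t) (\<beta> t)) z = lookup (expo_of n as bs) z" for z
      by (cases z) (auto simp: lookup_sum sum_\<alpha> sum_\<beta>)
  qed
  moreover have "trails n (\<Prod>t < d. alternant n 1 (\<alpha> t) (\<beta> t)) (\<Sum>t < d. expo_of n (\<alpha> t) (\<beta> t)) (\<Prod>t < d. 1)"
    by (intro trails_prod trails_alternant_strict strict)
  ultimately have "trails n (\<Prod>t < d. alternant n 1 (\<alpha> t) (\<beta> t)) (expo_of n as bs) 1" by simp
  from trails_mult[OF trails_base_monomial this]
  have "is_trailing n g (expo_vec n (single X a + single Y b + expo_of n as bs))"
    unfolding g_def by (rule is_trailingI) simp
  moreover have "g \<in> H0 n m k"
    unfolding H0_def d_def[symmetric]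
  proof (intro CollectI conjI IntI allI impI)
    have "(\<Prod>t < d. alternant n 1 (\<alpha> t) (\<beta> t)) \<in> ideal_J n [^]\<^bsub>ideals_set (poly_ring n)\<^esub> card {..<d}"
      by (intro prod_in_ideal_pow alternant_in_J) auto
    then show "g \<in> ideal_J n [^]\<^bsub>ideals_set (poly_ring n)\<^esub> d"
      unfolding g_def
      by (intro ideal_poly_ring_closed(4)[OF ideal_pow[OF ideal_J]] carrier_base_monomial) simp
    have "(\<Prod>t \<in> {m..<d}. alternant n 1 (\<alpha> t) (\<beta> t)) \<in> ideal_I n [^]\<^bsub>ideals_set (poly_ring n)\<^esub> card {m..<d}"
      by (intro prod_in_ideal_pow alternant_in_I) (auto simp: \<beta>_def)
    then have "pvar X ^ a * pvar Y ^ b * (\<Prod>t < m. alternant n 1 (\<alpha> t) (\<beta> t)) *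
        (\<Prod>t \<in> {m..<d}. alternant n 1 (\<alpha> t) (\<beta> t)) \<in> ideal_I n [^]\<^bsub>ideals_set (poly_ring n)\<^esub> card {m..<d}"
      by (intro ideal_poly_ring_closed(4)[OF ideal_pow[OF ideal_I]] carrier_base_monomial
          carrier_mult carrier_prod carrier_alternant)
    moreover have "(\<Prod>t < d. alternant n 1 (\<alpha> t) (\<beta> t)) =
        (\<Prod>t < m. alternant n 1 (\<alpha> t) (\<beta> t)) * (\<Prod>t \<in> {m..<d}. alternant n 1 (\<alpha> t) (\<beta> t))"
      by (simp add: d_def lessThan_atLeast0 prod.atLeastLessThan_concat)
    ultimately show "g \<in> ideal_I n [^]\<^bsub>ideals_set (poly_ring n)\<^esub> k"
      by (simp add: g_def d_def mult.assoc)
    fix \<sigma> assume \<sigma>: "\<sigma> permutes {1..n}"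
    have "perm_poly \<sigma> g = pvar X ^ a * pvar Y ^ b *
        (\<Prod>t < d. of_int (sgn_char 1 \<sigma>) * alternant n 1 (\<alpha> t) (\<beta> t))"
      unfolding g_def
      by (simp add: perm_poly_mult[OF permutes_bij[OF \<sigma>], of "pvar X ^ a * pvar Y ^ b"]
          perm_poly_base_monomial[OF \<sigma>] perm_poly_prod permutes_bij[OF \<sigma>] perm_poly_alternant[OF \<sigma>])
    also have "\<dots> = of_int (sgn_char 1 \<sigma> ^ d) * g"
      by (simp add: g_def prod.distrib mult_ac)
    finally show "perm_poly \<sigma> g = of_int (sgn_char d \<sigma>) * g"
      by (simp only: sgn_char_power)
  qed
  ultimately show ?thesis by blast
qed

section \<open>The trailing terms of sections\<close>

lemma int_bound:
  fixes A :: "nat \<Rightarrow> nat"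
  assumes "\<And>i. i \<in> {1..<j} \<Longrightarrow> A i \<le> A j"
  shows "max (int k - int (A j)) 0 + (\<Sum>i \<in> {1..<j}. max (int m + int k - (int (A j) - int (A i))) 0) =
    int ((k - A j) + (\<Sum>i \<in> {1..<j}. m + k - (A j - A i)))"
proof -
  have "max (int m + int k - (int (A j) - int (A i))) 0 = int (m + k - (A j - A i))"
    if "i \<in> {1..<j}" for i
    using assms[OF that] by (auto simp: max_def)
  moreover have "max (int k - int (A j)) 0 = int (k - A j)" by (auto simp: max_def)
  ultimately show ?thesis by simp
qed

theorem theorem1p4:
  fixes n m k :: nat and a b :: int and as bs :: "nat \<Rightarrow> int"
  assumes "n \<ge> 1"
  shows "(\<exists>g \<in> H0 n m k. is_trailing n g (exp_vec n a b as bs)) \<longleftrightarrow>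
     (a \<ge> 0 \<and> b \<ge> 0) \<and>
     (0 \<le> as 1 \<and> (\<forall>j \<in> {1..<n}. as j \<le> as (j + 1))) \<and>
     (\<forall>j \<in> {1..<n}. as j = as (j + 1) \<longrightarrow> bs (j + 1) \<ge> bs j + int m + int k) \<and>
     (\<forall>j \<in> {1..n}. bs j \<ge> max (int k - as j) 0
        + (\<Sum>i \<in> {1..<j}. max (int m + int k - (as j - as i)) 0))"
proof (rule iffI, elim bexE, goal_cases)
  case (1 g)
  then obtain e0 where "trailing_section n (m + k) k g e0" and e0: "exp_vec n a b as bs = expo_vec n e0"
    using trailing_section_H0 by blast
  then interpret trailing_section n "m + k" k g e0 by simp
  define A where "A i = lookup e0 (Xi i)" for i
  have ab: "a = int (lookup e0 X)" "b = int (lookup e0 Y)"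
    and as: "\<And>i. i \<in> {1..n} \<Longrightarrow> as i = int (A i)"
    and bs: "\<And>i. i \<in> {1..n} \<Longrightarrow> bs i = int (lookup e0 (Yi i))"
    using e0 unfolding exp_vec_eq_expo_vec_iff by (auto simp: A_def)
  show ?case
  proof (intro conjI ballI impI)
    show "a \<ge> 0" "b \<ge> 0" "0 \<le> as 1" using ab as[of 1] assms by auto
    show "as j \<le> as (j + 1)" if "j \<in> {1..<n}" for j
      using that as[of j] as[of "j + 1"] as_mono[of j "j + 1"] by (simp add: A_def)
    show "bs (j + 1) \<ge> bs j + int m + int k" if "j \<in> {1..<n}" "as j = as (j + 1)" for j
      using that as[of j] as[of "j + 1"] bs[of j] bs[of "j + 1"] tie_gap[of j "j + 1"]
      by (simp add: A_def)
    fix j assume j: "j \<in> {1..n}"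
    have "max (int k - as j) 0 + (\<Sum>i \<in> {1..<j}. max (int m + int k - (as j - as i)) 0) =
        max (int k - int (A j)) 0 + (\<Sum>i \<in> {1..<j}. max (int m + int k - (int (A j) - int (A i))) 0)"
      using j as by simp
    also have "\<dots> = int ((k - A j) + (\<Sum>i \<in> {1..<j}. m + k - (A j - A i)))"
      using j as_mono by (intro int_bound) (auto simp: A_def)
    also have "\<dots> \<le> int (lookup e0 (Yi j))"
      using Yi_bound[of j j e0] j key by (simp add: A_def del: of_nat_add)
    finally show "bs j \<ge> max (int k - as j) 0 + (\<Sum>i \<in> {1..<j}. max (int m + int k - (as j - as i)) 0)"
      using bs[OF j] by simp
  qed
next
  case 2
  have mono: "as i \<le> as j" if "1 \<le> i" "i \<le> j" "j \<le> n" for i j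
    using that(2,1,3)
  proof (induction j rule: dec_induct)
    case (step j)
    then have "as i \<le> as j" by simp
    also have "as j \<le> as (Suc j)" using 2 step by auto
    finally show ?case .
  qed simp
  define A B where "A i = nat (as i)" and "B i = nat (bs i)" for i
  have as: "as i = int (A i)" if "i \<in> {1..n}" for i
    using mono[of 1 i] that 2 by (simp add: A_def)
  have bs: "bs i = int (B i)" if i: "i \<in> {1..n}" for i
  proof -
    have "0 \<le> max (int k - as i) 0 + (\<Sum>l \<in> {1..<i}. max (int m + int k - (as i - as l)) 0)"
      by (intro add_nonneg_nonneg sum_nonneg) auto
    then have "0 \<le> bs i" using 2 i by fastforce
    then show ?thesis by (simp add: B_def)
  qed
  have Amono: "A i \<le> A j" if "1 \<le> i" "i \<le> j" "j \<le> n" for i j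
    using mono[OF that] by (simp add: A_def)
  have tie: "B j + (m + k) \<le> B (Suc j)" if "1 \<le> j" "j < n" "A j = A (Suc j)" for j
  proof -
    have "bs (j + 1) \<ge> bs j + int m + int k"
      using 2 that as[of j] as[of "Suc j"] by auto
    then show ?thesis using bs[of j] bs[of "Suc j"] that by simp
  qed
  have bound: "(k - A j) + (\<Sum>i \<in> {1..<j}. m + k - (A j - A i)) \<le> B j" if j: "1 \<le> j" "j \<le> n" for j
  proof -
    have "int ((k - A j) + (\<Sum>i \<in> {1..<j}. m + k - (A j - A i))) =
        max (int k - int (A j)) 0 + (\<Sum>i \<in> {1..<j}. max (int m + int k - (int (A j) - int (A i))) 0)"
      using j Amono by (intro int_bound[symmetric]) auto
    also have "\<dots> = max (int k - as j) 0 + (\<Sum>i \<in> {1..<j}. max (int m + int k - (as j - as i)) 0)"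
      using j as by simp
    also have "\<dots> \<le> bs j" using 2 j by auto
    also have "bs j = int (B j)" using bs[of j] j by simp
    finally show ?thesis by (simp only: of_nat_le_iff)
  qed
  define e where "e = single X (nat a) + single Y (nat b) + expo_of n A B"
  have "\<exists>g \<in> H0 n m k. is_trailing n g (expo_vec n e)"
  proof (cases "m + k = 0")
    case True
    \<comment> \<open>For \<open>m + k = 0\<close> the tie condition says that equal \<open>a\<close>-exponents carry sorted \<open>b\<close>-exponents.\<close>
    have "A i < A j \<or> A i = A j \<and> B i \<le> B j" if "1 \<le> i" "i < j" "j \<le> n" for i j
      using that(2,1,3)
    proof (induction i rule: strict_inc_induct)
      case (base i)
      then show ?case using Amono[of i "Suc i"] tie[of i] by fastforce
    next
      case (step i)
      then show ?case using Amono[of i "Suc i"] tie[of i] by fastforce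
    qed
    then show ?thesis using True section_exists_0[of n A B "nat a" "nat b"] by (simp add: e_def)
  next
    case False
    then show ?thesis unfolding e_def using Amono tie bound by (intro section_exists_pos) auto
  qed
  moreover have "exp_vec n a b as bs = expo_vec n e"
    using 2 as bs by (simp add: exp_vec_eq_expo_vec_iff e_def lookup_add lookup_single)
  ultimately show ?case by simp
qed

end
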